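(* Suppose that $0\le\theta<\frac{\pi}{2}$, and let $D_\theta := \{re^{i\alpha} : r\ge 0 \text{ and } |\alpha|\le\theta\}$. Let $f:\mathbb{C}\to\mathbb{C}$ be holomorphic in a domain containing $D_\theta$, except for a simple pole at the origin, and assume that $f$ and all of its derivatives are of sufficient decay in $D_\theta$. If $f(w)=\sum_{n\ge -1}b_n w^n$ near $0$, then for $a\in\mathbb{R}$, $a\notin-\mathbb{N}_0$, and $N\in\mathbb{N}_0$, uniformly, as $w\to0$ in $D_\theta$, $$\sum_{m\ge0} f(w(m+a)) = \frac{b_{-1}\operatorname{Log}\left(\frac1w\right)}{w}+\frac{b_{-1}C_a}{w}+\frac1w\int_0^\infty\left(f(x)-\frac{b_{-1}e^{-x}}{x}\right)dx-\sum_{n=0}^{N-1}\frac{B_{n+1}(a)\,b_n}{n+1}w^n+O_N(w^N).$$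
   Context: A function $g$ is of sufficient decay in a domain $D\subset\mathbb{C}$ if there exists some $\varepsilon>0$ such that $g(w)\ll |w|^{-1-\varepsilon}$ as $|w|\to\infty$ in $D$ (the $\varepsilon$ may be different for different derivatives of $f$). $\mathbb{N}_0=\{0,1,2,\dots\}$ and $-\mathbb{N}_0=\{0,-1,-2,\dots\}$. For $a\in\mathbb{R}$, $a\notin-\mathbb{N}_0$, the constant $C_a$ is $$C_a:=(1-a)\sum_{m\ge0}\frac{1}{(m+a)(m+1)}.$$ $\operatorname{Log}$ is the principal branch of the complex logarithm, $\operatorname{Log}(z)=\log|z|+i\operatorname{Arg}(z)$ with $\operatorname{Arg}(z)\in(-\pi,\pi]$. The Bernoulli polynomials $B_n(x)$ are defined by $\sum_{n\ge0}B_n(x)\frac{t^n}{n!}=\frac{te^{tx}}{e^t-1}$. The limit is over $w\in D_\theta\setminus\{0\}$, and the $O_N$-constant may depend on $f,a,\theta,N$ but not on $w$. *)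

theory Defs
  imports
    "HOL-Complex_Analysis.Complex_Analysis"
    "HOL-Library.Landau_Symbols"
    "HOL-Library.Nonpos_Ints"
begin

definition sector :: "real \<Rightarrow> complex set" where
  "sector \<theta> = {of_real r * cis \<alpha> |r \<alpha>. r \<ge> 0 \<and> \<bar>\<alpha>\<bar> \<le> \<theta>}"

definition sufficient_decay :: "complex set \<Rightarrow> (complex \<Rightarrow> complex) \<Rightarrow> bool" where
  "sufficient_decay D g \<longleftrightarrow>
     (\<exists>\<epsilon>>0. (\<lambda>w. norm (g w)) \<in> O[inf at_infinity (principal D)](\<lambda>w. norm w powr (-1 - \<epsilon>)))"

definition C_const :: "real \<Rightarrow> real" where
  "C_const a = (1 - a) * (\<Sum>m. 1 / ((real m + a) * (real m + 1)))"

definition bernoulli_poly :: "nat \<Rightarrow> real \<Rightarrow> real" where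
  "bernoulli_poly n x = fact n * fps_nth (fps_X * fps_exp x / (fps_exp 1 - 1)) n"

text \<open>Division of formal power series is truncating in general; here it is exact, so this is the
  usual generating function identity, multiplied out.\<close>

lemma bernoulli_poly_egf:
  "(fps_exp 1 - 1) * Abs_fps (\<lambda>n. bernoulli_poly n x / fact n) = fps_X * fps_exp (x::real)"
proof -
  have nz: "fps_nth (fps_exp (1::real) - 1) 1 \<noteq> 0" by simp
  hence nz': "fps_exp (1::real) - 1 \<noteq> 0" by (metis fps_zero_nth)
  have "subdegree (fps_exp (1::real) - 1) = 1"
    by (intro subdegreeI) auto
  moreover have "subdegree (fps_X * fps_exp x) = 1"
    by (intro subdegreeI) auto
  ultimately have "(fps_exp (1::real) - 1) dvd fps_X * fps_exp x"
    using nz' by (subst fps_dvd_iff) auto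
  moreover have "Abs_fps (\<lambda>n. bernoulli_poly n x / fact n) = fps_X * fps_exp x / (fps_exp 1 - 1)"
    by (simp add: bernoulli_poly_def fps_eq_iff)
  ultimately show ?thesis by simp
qed

end

theory Submission
  imports Defs
begin

text \<open>
The sum is a Riemann sum of step \<open>w\<close>, and the expansion is the Euler--Maclaurin formula, modified
by the simple pole at the left end point. Write \<open>f(z) = g(z) + b\<^sub>-\<^sub>1 exp (- z) / z\<close>. Then \<open>g\<close> is
holomorphic near the whole sector and, like \<open>f\<close>, decays with all its derivatives
(\<open>subtract_simple_pole\<close>).

For \<open>g\<close> and \<open>a > 0\<close>, let \<open>G\<close> be the antiderivative that vanishes at infinity, so that \<open>- G(0)\<close> is the
integral of \<open>g\<close> over the positive reals (\<open>decaying_primitive\<close>). Put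
\<open>F(z) = \<Sum>n\<le>N. B\<^sub>n(a) / n! * w ^ n * G^(n)(z)\<close>. Taylor's theorem and the generating function of the
Bernoulli polynomials give \<open>F(z + w) - F(z) = w g(z + a w)\<close> up to terms of order \<open>w ^ (N + 2)\<close>.
Summed over \<open>z = 0, w, 2w, \<dots>\<close> the left side telescopes to \<open>- F(0)\<close>, and because the decay makes the
Riemann sums of the remainders bounded, only one power of \<open>w\<close> is lost (\<open>euler_maclaurin_cone\<close>). Division
by \<open>w\<close> gives the expansion for \<open>g\<close>.

For \<open>exp (- z) / z\<close> the sum is \<open>h(w) / w\<close> with \<open>h(w) = \<Sum>m. exp (- w (m + a)) / (m + a)\<close>. The derivative
of \<open>h\<close> is a sum of exponentials, which Euler--Maclaurin expands as \<open>- 1 / w\<close> plus a power series.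
Integrating gives \<open>h(w) = - Log w + C\<^sub>a + \<dots>\<close>, with the constant determined on the positive reals
(\<open>damped_harmonic_asymptotics\<close>).

Adding the two expansions proves the claim for \<open>a > 0\<close>. Any other \<open>a\<close> is reached by finitely many
steps from \<open>a + 1\<close> to \<open>a\<close>, each of which adds one summand, expanded by the Laurent series of \<open>f\<close>
(\<open>expansion_error_shift\<close>).
\<close>

section \<open>Bernoulli polynomials\<close>

text \<open>This is the coefficient of \<open>t ^ (p + 1)\<close> in \<open>(e^t - 1) E(t) = t e^(a t)\<close>, where \<open>E\<close> is the
exponential generating function. It is the only property of Bernoulli polynomials on which the
Euler--Maclaurin expansion rests.\<close>

lemma bernoulli_poly_convolution:
  "(\<Sum>n\<le>p. bernoulli_poly n a / fact n / fact (Suc p - n)) = a ^ p / fact p"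
proof -
  let ?E = "Abs_fps (\<lambda>n. bernoulli_poly n a / fact n)"
  have "a ^ p / fact p = fps_nth (fps_X * fps_exp a) (Suc p)"
    by simp
  also have "\<dots> = fps_nth (?E * (fps_exp 1 - 1)) (Suc p)"
    using bernoulli_poly_egf[of a] by (simp add: mult.commute)
  also have "\<dots> = (\<Sum>n=0..Suc p. bernoulli_poly n a / fact n * fps_nth (fps_exp 1 - 1) (Suc p - n))"
    by (simp add: fps_mult_nth)
  also have "\<dots> = (\<Sum>n\<le>p. bernoulli_poly n a / fact n * fps_nth (fps_exp 1 - 1) (Suc p - n))"
    by (simp add: atMost_atLeast0 mult.commute)
  also have "\<dots> = (\<Sum>n\<le>p. bernoulli_poly n a / fact n / fact (Suc p - n))"
    by (intro sum.cong) auto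
  finally show ?thesis by simp
qed

lemma bernoulli_poly_0 [simp]: "bernoulli_poly 0 a = 1"
  using bernoulli_poly_convolution[where p = 0 and a = a] by simp

text \<open>The generating functions for \<open>a + 1\<close> and \<open>a\<close> differ by \<open>t e^(a t)\<close>: multiply the difference by
\<open>e^t - 1\<close> and cancel. This recurrence carries the expansion from \<open>a + 1\<close> down to \<open>a\<close>.\<close>

lemma bernoulli_poly_plus1:
  "bernoulli_poly (Suc n) (a + 1) = bernoulli_poly (Suc n) a + real (Suc n) * a ^ n"
proof -
  let ?E = "\<lambda>x::real. Abs_fps (\<lambda>n. bernoulli_poly n x / fact n)"
  have "fps_nth (fps_exp (1::real) - 1) 1 \<noteq> 0"
    by simp
  hence nz: "fps_exp (1::real) - 1 \<noteq> 0"
    by (metis fps_zero_nth)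
  have "(fps_exp 1 - 1) * (?E (a + 1) - ?E a) = (fps_exp 1 - 1) * (fps_X * fps_exp a)"
    unfolding right_diff_distrib bernoulli_poly_egf
    by (simp add: fps_exp_add_mult algebra_simps)
  hence "?E (a + 1) - ?E a = fps_X * fps_exp a"
    using nz by simp
  hence "fps_nth (?E (a + 1) - ?E a) (Suc n) = fps_nth (fps_X * fps_exp a) (Suc n)"
    by simp
  hence "(bernoulli_poly (Suc n) (a + 1) - bernoulli_poly (Suc n) a) / fact (Suc n) = a ^ n / fact n"
    by (simp add: diff_divide_distrib)
  hence "bernoulli_poly (Suc n) (a + 1) - bernoulli_poly (Suc n) a = a ^ n / fact n * fact (Suc n)"
    by (subst (asm) divide_eq_eq) simp
  also have "\<dots> = real (Suc n) * a ^ n"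
    by (simp only: fact_Suc of_nat_Suc) simp
  finally show ?thesis
    by simp
qed

section \<open>The Euler--Maclaurin expansion along a ray\<close>

text \<open>The sum from \<open>m = 1\<close> on is a lower Riemann sum of the integral of \<open>(1 + x) powr (-1 - \<epsilon>)\<close> over the
positive half-line, which is \<open>1 / \<epsilon>\<close>; the first summand is \<open>h\<close>. What matters is that the bound
does not blow up as the step \<open>h\<close> shrinks: summing Taylor remainders along a ray with step
\<open>h = norm w\<close> then costs only one power of \<open>norm w\<close>.\<close>

lemma sum_powr_riemann_bound:
  fixes h \<epsilon> :: real
  assumes "h > 0" "\<epsilon> > 0"
  shows "(\<Sum>m<n. h * (1 + real m * h) powr (-1 - \<epsilon>)) \<le> h + 1 / \<epsilon>"
proof (cases n)
  case 0
  thus ?thesis using assms by simp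
next
  case (Suc k)
  \<comment> \<open>Telescoping: \<open>- (1 + x) powr (-\<epsilon>) / \<epsilon>\<close> is an antiderivative of the summand.\<close>
  have "(\<Sum>m<Suc k. h * (1 + real m * h) powr (-1 - \<epsilon>)) \<le> h + (1 - (1 + real k * h) powr (-\<epsilon>)) / \<epsilon>"
  proof (induction k)
    case (Suc k)
    let ?x = "1 + real k * h" and ?y = "1 + real (Suc k) * h"
    have x: "?x > 0" "?x < ?y" using assms by (auto simp: add_pos_nonneg algebra_simps)
    have "\<exists>z. ?x < z \<and> z < ?y \<and> ?y powr (-\<epsilon>) - ?x powr (-\<epsilon>) = (?y - ?x) * (-\<epsilon> * z powr (-\<epsilon> - 1))"
      using x by (intro MVT2) (auto intro!: DERIV_powr derivative_eq_intros)
    then obtain z where z: "?x < z" "z < ?y"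
      "?y powr (-\<epsilon>) - ?x powr (-\<epsilon>) = (?y - ?x) * (-\<epsilon> * z powr (-\<epsilon> - 1))" by blast
    have "?y powr (-1 - \<epsilon>) \<le> z powr (-\<epsilon> - 1)"
    proof -
      have "?y powr (-\<epsilon> - 1) \<le> z powr (-\<epsilon> - 1)"
        using z(1,2) x assms by (intro powr_mono2') auto
      thus ?thesis by (simp add: minus_diff_commute)
    qed
    hence "h * ?y powr (-1 - \<epsilon>) \<le> h * z powr (-\<epsilon> - 1)"
      using assms by simp
    also have "\<dots> = (?x powr (-\<epsilon>) - ?y powr (-\<epsilon>)) / \<epsilon>"
      using z(3) assms by (simp add: field_simps)
    finally have "h * ?y powr (-1 - \<epsilon>) \<le> (?x powr (-\<epsilon>) - ?y powr (-\<epsilon>)) / \<epsilon>" .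
    with Suc show ?case by (simp add: diff_divide_distrib)
  qed (use assms in auto)
  also have "\<dots> \<le> h + 1 / \<epsilon>"
    using assms by (intro add_mono divide_right_mono) auto
  finally show ?thesis using Suc by simp
qed

text \<open>In terms of the derivation \<open>\<partial>\<close>, the sum \<open>F w\<close> is the operator \<open>w\<partial> e^(a w\<partial>) / (e^(w\<partial>) - 1)\<close>, truncated
and applied to \<open>D 0\<close>, and \<open>e^(w\<partial>)\<close> is the shift by \<open>w\<close>. So the forward difference of \<open>F w\<close> with step \<open>w\<close>
ought to be \<open>w\<partial> e^(a w\<partial>)\<close> applied to \<open>D 0\<close>, that is \<open>w * D 1 (z + a * w)\<close>. Because of the truncation
this holds up to Taylor remainders, all of which are governed by the derivative of order \<open>N + 2\<close>.\<close>

lemma bernoulli_operator_step: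
  fixes D :: "nat \<Rightarrow> complex \<Rightarrow> complex" and a :: real and N :: nat
  defines "\<beta> \<equiv> \<lambda>n. bernoulli_poly n a / fact n"
  defines "F \<equiv> \<lambda>w z. \<Sum>n\<le>N. of_real (\<beta> n) * w ^ n * D n z"
  assumes X: "convex X" and mem: "z \<in> X" "z + w \<in> X" "z + of_real a * w \<in> X"
  assumes D: "\<And>n x. x \<in> X \<Longrightarrow> (D n has_field_derivative D (Suc n) x) (at x within X)"
  assumes B: "\<And>x. x \<in> X \<Longrightarrow> norm (D (N + 2) x) \<le> B"
  shows "norm (F w (z + w) - F w z - w * D 1 (z + of_real a * w))
           \<le> ((\<Sum>n\<le>N. \<bar>\<beta> n\<bar>) + \<bar>a\<bar> ^ (N + 1)) * norm w ^ (N + 2) * B"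
proof -
  have B0: "B \<ge> 0" using B[OF mem(1)] norm_ge_zero by (rule order_trans[rotated])
  define R where "R n = D n (z + w) - (\<Sum>i\<le>N + 1 - n. D (n + i) z * w ^ i / fact i)" for n
  define R' where "R' = D 1 (z + of_real a * w) - (\<Sum>i\<le>N. D (1 + i) z * (of_real a * w) ^ i / fact i)"
  have R: "norm (R n) \<le> B * norm w ^ (N + 2 - n)" if "n \<le> N" for n
  proof -
    have "norm (D (n + 0) (z + w) - (\<Sum>i\<le>N + 1 - n. D (n + i) z * (z + w - z) ^ i / fact i))
            \<le> B * norm (z + w - z) ^ Suc (N + 1 - n) / fact (N + 1 - n)"
      using X mem that B by (intro complex_Taylor[where S = X]) (auto intro!: D)
    also have "\<dots> \<le> B * norm w ^ Suc (N + 1 - n) / 1"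
      using B0 by (subst add_diff_cancel_left', intro divide_left_mono mult_nonneg_nonneg) auto
    finally show ?thesis using that by (simp add: R_def Suc_diff_le)
  qed
  have R': "norm R' \<le> B * norm (of_real a * w) ^ (N + 1)"
  proof -
    have "norm (D (1 + 0) (z + of_real a * w) - (\<Sum>i\<le>N. D (1 + i) z * (z + of_real a * w - z) ^ i / fact i))
            \<le> B * norm (z + of_real a * w - z) ^ Suc N / fact N"
      using X mem B by (intro complex_Taylor[where S = X]) (auto intro!: D)
    also have "\<dots> \<le> B * norm (of_real a * w) ^ Suc N / 1"
      using B0 by (subst add_diff_cancel_left', intro divide_left_mono mult_nonneg_nonneg) auto
    finally show ?thesis by (simp add: R'_def)
  qed
  \<comment> \<open>The Taylor polynomials cancel exactly, by the convolution identity.\<close>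
  have main: "(\<Sum>n\<le>N. of_real (\<beta> n) * w ^ n * ((\<Sum>i\<le>N + 1 - n. D (n + i) z * w ^ i / fact i) - D n z))
        = w * (\<Sum>i\<le>N. D (1 + i) z * (of_real a * w) ^ i / fact i)"
  proof -
    have "(\<Sum>n\<le>N. of_real (\<beta> n) * w ^ n * ((\<Sum>i\<le>N + 1 - n. D (n + i) z * w ^ i / fact i) - D n z))
        = (\<Sum>n\<le>N. \<Sum>j\<le>N - n. of_real (\<beta> n) * w ^ n * (D (n + Suc j) z * w ^ Suc j / fact (Suc j)))"
    proof (intro sum.cong refl)
      fix n assume "n \<in> {..N}"
      hence eq: "N + 1 - n = Suc (N - n)" by auto
      have "(\<Sum>i\<le>N + 1 - n. D (n + i) z * w ^ i / fact i) - D n z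
          = (\<Sum>j\<le>N - n. D (n + Suc j) z * w ^ Suc j / fact (Suc j))"
        unfolding eq by (subst sum.atMost_Suc_shift) simp
      thus "of_real (\<beta> n) * w ^ n * ((\<Sum>i\<le>N + 1 - n. D (n + i) z * w ^ i / fact i) - D n z)
          = (\<Sum>j\<le>N - n. of_real (\<beta> n) * w ^ n * (D (n + Suc j) z * w ^ Suc j / fact (Suc j)))"
        by (simp add: sum_distrib_left)
    qed
    also have "\<dots> = (\<Sum>(n,j)\<in>{(i,j). i + j \<le> N}. of_real (\<beta> n) * w ^ n * (D (n + Suc j) z * w ^ Suc j / fact (Suc j)))"
      by (subst sum.Sigma) (auto intro!: sum.cong)
    also have "\<dots> = (\<Sum>p\<le>N. \<Sum>n\<le>p. of_real (\<beta> n) * w ^ n * (D (n + Suc (p - n)) z * w ^ Suc (p - n) / fact (Suc (p - n))))"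
      by (rule sum.triangle_reindex_eq)
    also have "\<dots> = (\<Sum>p\<le>N. w ^ Suc p * D (Suc p) z * of_real (\<Sum>n\<le>p. \<beta> n / fact (Suc p - n)))"
    proof (intro sum.cong refl)
      fix p
      have "of_real (\<beta> n) * w ^ n * (D (n + Suc (p - n)) z * w ^ Suc (p - n) / fact (Suc (p - n)))
          = w ^ Suc p * D (Suc p) z * of_real (\<beta> n / fact (Suc p - n))" if "n \<le> p" for n
      proof -
        have "w ^ n * w ^ Suc (p - n) = w ^ Suc p" using that by (simp flip: power_add)
        moreover have "n + Suc (p - n) = Suc p" "Suc (p - n) = Suc p - n" using that by auto
        ultimately show ?thesis by (simp only:) (simp add: field_simps)
      qed
      thus "(\<Sum>n\<le>p. of_real (\<beta> n) * w ^ n * (D (n + Suc (p - n)) z * w ^ Suc (p - n) / fact (Suc (p - n))))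
          = w ^ Suc p * D (Suc p) z * of_real (\<Sum>n\<le>p. \<beta> n / fact (Suc p - n))"
        by (simp add: sum_distrib_left)
    qed
    also have "\<dots> = w * (\<Sum>i\<le>N. D (1 + i) z * (of_real a * w) ^ i / fact i)"
      unfolding \<beta>_def bernoulli_poly_convolution
      by (simp add: sum_distrib_left power_mult_distrib field_simps)
    finally show ?thesis .
  qed
  have "F w (z + w) - F w z - w * D 1 (z + of_real a * w)
      = (\<Sum>n\<le>N. of_real (\<beta> n) * w ^ n * (R n + ((\<Sum>i\<le>N + 1 - n. D (n + i) z * w ^ i / fact i) - D n z)))
          - w * (R' + (\<Sum>i\<le>N. D (1 + i) z * (of_real a * w) ^ i / fact i))"
    unfolding F_def R_def R'_def by (simp add: sum_subtractf algebra_simps)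
  also have "\<dots> = (\<Sum>n\<le>N. of_real (\<beta> n) * w ^ n * R n) - w * R'"
    unfolding distrib_left sum.distrib main by simp
  finally have eq: "F w (z + w) - F w z - w * D 1 (z + of_real a * w)
       = (\<Sum>n\<le>N. of_real (\<beta> n) * w ^ n * R n) - w * R'" .
  have "norm (\<Sum>n\<le>N. of_real (\<beta> n) * w ^ n * R n) \<le> (\<Sum>n\<le>N. \<bar>\<beta> n\<bar> * (norm w ^ (N + 2) * B))"
  proof (rule sum_norm_le)
    fix n assume n: "n \<in> {..N}"
    have "norm (of_real (\<beta> n) * w ^ n * R n) \<le> \<bar>\<beta> n\<bar> * norm w ^ n * (B * norm w ^ (N + 2 - n))"
      unfolding norm_mult norm_power norm_of_real using n by (intro mult_left_mono R) auto
    also have "\<dots> = \<bar>\<beta> n\<bar> * ((norm w ^ n * norm w ^ (N + 2 - n)) * B)" by (simp only: mult_ac)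
    also have "norm w ^ n * norm w ^ (N + 2 - n) = norm w ^ (N + 2)" using n by (simp flip: power_add)
    finally show "norm (of_real (\<beta> n) * w ^ n * R n) \<le> \<bar>\<beta> n\<bar> * (norm w ^ (N + 2) * B)" .
  qed
  moreover have "norm (w * R') \<le> norm w * (B * (\<bar>a\<bar> * norm w) ^ (N + 1))"
    using R' by (simp add: norm_mult mult_left_mono)
  ultimately have "norm ((\<Sum>n\<le>N. of_real (\<beta> n) * w ^ n * R n) - w * R')
      \<le> (\<Sum>n\<le>N. \<bar>\<beta> n\<bar> * (norm w ^ (N + 2) * B)) + norm w * (B * (\<bar>a\<bar> * norm w) ^ (N + 1))"
    by (intro order_trans[OF norm_triangle_ineq4] add_mono)
  also have "\<dots> = ((\<Sum>n\<le>N. \<bar>\<beta> n\<bar>) + \<bar>a\<bar> ^ (N + 1)) * norm w ^ (N + 2) * B"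
    unfolding sum_distrib_right [symmetric] by (simp add: power_mult_distrib algebra_simps)
  finally show ?thesis unfolding eq .
qed

text \<open>Summing the previous lemma over \<open>z = m * w\<close> telescopes. The boundary term at infinity vanishes by
the limit hypothesis, and the boundary term at \<open>0\<close> is the Euler--Maclaurin expansion. The summands
are sampled on the ray through \<open>w\<close> only, so no path has to be deformed here and no
periodic Bernoulli function appears.\<close>

lemma euler_maclaurin_cone:
  fixes D :: "nat \<Rightarrow> complex \<Rightarrow> complex" and a :: real and N :: nat
  assumes T: "convex T" "cone T" and w: "w \<in> T" "w \<noteq> 0" "norm w \<le> 1" and a: "a > 0" and e: "\<epsilon> > 0"
  assumes D: "\<And>n z. z \<in> T \<Longrightarrow> (D n has_field_derivative D (Suc n) z) (at z within T)"
  assumes lim: "\<And>n. n \<le> N \<Longrightarrow> (\<lambda>m. D n (of_nat m * w)) \<longlonglongrightarrow> 0"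
  assumes B: "\<And>z. z \<in> T \<Longrightarrow> norm (D (N + 2) z) \<le> K * (1 + norm z) powr (-1 - \<epsilon>)"
  assumes sm: "summable (\<lambda>m. D 1 (w * of_real (real m + a)))"
  shows "norm (w * (\<Sum>m. D 1 (w * of_real (real m + a)))
                 + (\<Sum>n\<le>N. of_real (bernoulli_poly n a / fact n) * w ^ n * D n 0))
         \<le> ((\<Sum>n\<le>N. \<bar>bernoulli_poly n a / fact n\<bar>) + \<bar>a\<bar> ^ (N + 1)) * K * (1 + 1 / \<epsilon>) * norm w ^ (N + 1)"
proof -
  define F where "F z = (\<Sum>n\<le>N. of_real (bernoulli_poly n a / fact n) * w ^ n * D n z)" for z
  define M where "M = (\<Sum>n\<le>N. \<bar>bernoulli_poly n a / fact n\<bar>) + \<bar>a\<bar> ^ (N + 1)"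
  define A where "A = max 1 a"
  have M0: "M \<ge> 0" unfolding M_def by (intro add_nonneg_nonneg sum_nonneg) auto
  have K0: "K \<ge> 0"
  proof -
    have "0 \<le> K * (1 + norm w) powr (-1 - \<epsilon>)" using B[OF w(1)] norm_ge_zero by (rule order_trans[rotated])
    moreover have "(1 + norm w) powr (-1 - \<epsilon>) > 0"
      by (metis add_nonneg_eq_0_iff norm_ge_zero powr_gt_zero zero_le_one zero_neq_one)
    ultimately show ?thesis by (simp add: zero_le_mult_iff)
  qed
  have step: "norm (F (of_nat (Suc m) * w) - F (of_nat m * w) - w * D 1 (w * of_real (real m + a)))
      \<le> M * K * norm w ^ (N + 1) * (norm w * (1 + real m * norm w) powr (-1 - \<epsilon>))" for m
  proof -
    \<comment> \<open>A segment of the ray that contains the three points used in step \<open>m\<close>; all its points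
      have norm at least \<open>m * norm w\<close>.\<close>
    let ?X = "(\<lambda>t. of_real t * w) ` {real m..real m + A}"
    have XT: "?X \<subseteq> T"
      using T(2) w(1) by (auto simp: cone_def scaleR_conv_of_real)
    have convX: "convex ?X"
      by (intro convex_linear_image linearI) (auto simp: algebra_simps scaleR_conv_of_real)
    have "norm (F (of_nat m * w + w) - F (of_nat m * w) - w * D 1 (of_nat m * w + of_real a * w))
      \<le> M * norm w ^ (N + 2) * (K * (1 + real m * norm w) powr (-1 - \<epsilon>))"
      unfolding F_def M_def
    proof (rule bernoulli_operator_step[OF convX])
      show "of_nat m * w \<in> ?X" using a by (intro image_eqI[of _ _ "real m"]) (auto simp: A_def)
      show "of_nat m * w + w \<in> ?X" using a by (intro image_eqI[of _ _ "real m + 1"]) (auto simp: A_def algebra_simps)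
      show "of_nat m * w + of_real a * w \<in> ?X" using a by (intro image_eqI[of _ _ "real m + a"]) (auto simp: A_def algebra_simps)
      show "(D n has_field_derivative D (Suc n) x) (at x within ?X)" if "x \<in> ?X" for n x
        using D XT that by (meson DERIV_subset subsetD)
      show "norm (D (N + 2) x) \<le> K * (1 + real m * norm w) powr (-1 - \<epsilon>)" if "x \<in> ?X" for x
      proof -
        from that obtain t where t: "t \<ge> real m" "x = of_real t * w" by auto
        have "norm (D (N + 2) x) \<le> K * (1 + norm x) powr (-1 - \<epsilon>)"
          using that XT by (intro B) auto
        also have "(1 + norm x) powr (-1 - \<epsilon>) \<le> (1 + real m * norm w) powr (-1 - \<epsilon>)"
          using t e by (intro powr_mono2') (auto simp: norm_mult add_pos_nonneg intro!: mult_right_mono)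
        finally show ?thesis using K0 by (simp add: mult_left_mono)
      qed
    qed
    thus ?thesis by (simp add: algebra_simps)
  qed
  have part: "norm (F (of_nat n * w) - F 0 - w * (\<Sum>m<n. D 1 (w * of_real (real m + a))))
      \<le> M * K * (1 + 1 / \<epsilon>) * norm w ^ (N + 1)" for n
  proof -
    have "F (of_nat n * w) - F 0 - w * (\<Sum>m<n. D 1 (w * of_real (real m + a)))
        = (\<Sum>m<n. F (of_nat (Suc m) * w) - F (of_nat m * w) - w * D 1 (w * of_real (real m + a)))"
      by (induction n) (simp_all add: algebra_simps)
    also have "norm \<dots> \<le> (\<Sum>m<n. M * K * norm w ^ (N + 1) * (norm w * (1 + real m * norm w) powr (-1 - \<epsilon>)))"
      by (intro sum_norm_le step)
    also have "\<dots> = M * K * norm w ^ (N + 1) * (\<Sum>m<n. norm w * (1 + real m * norm w) powr (-1 - \<epsilon>))"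
      by (simp add: sum_distrib_left)
    also have "\<dots> \<le> M * K * norm w ^ (N + 1) * (1 + 1 / \<epsilon>)"
      using sum_powr_riemann_bound[of "norm w" \<epsilon> n] w e M0 K0
      by (intro mult_left_mono) auto
    finally show ?thesis by (simp add: mult_ac)
  qed
  have "(\<lambda>n. F (of_nat n * w)) \<longlonglongrightarrow> (\<Sum>n\<le>N. of_real (bernoulli_poly n a / fact n) * w ^ n * 0)"
    unfolding F_def by (intro tendsto_intros lim) auto
  hence "(\<lambda>n. norm (F (of_nat n * w) - F 0 - w * (\<Sum>m<n. D 1 (w * of_real (real m + a)))))
      \<longlonglongrightarrow> norm (0 - F 0 - w * (\<Sum>m. D 1 (w * of_real (real m + a))))"
    by (intro tendsto_intros summable_LIMSEQ sm) auto
  hence "norm (0 - F 0 - w * (\<Sum>m. D 1 (w * of_real (real m + a)))) \<le> M * K * (1 + 1 / \<epsilon>) * norm w ^ (N + 1)"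
    using part by (intro LIMSEQ_le_const2) auto
  also have "norm (0 - F 0 - w * (\<Sum>m. D 1 (w * of_real (real m + a))))
      = norm (w * (\<Sum>m. D 1 (w * of_real (real m + a))) + F 0)"
    by (subst norm_minus_cancel [symmetric]) (simp add: algebra_simps)
  finally show ?thesis unfolding F_def M_def .
qed

section \<open>Geometry of the sector\<close>

text \<open>Convexity and closedness are much easier to see from linear
inequalities than from polar coordinates.\<close>

lemma sector_altdef:
  assumes "0 \<le> \<theta>" "\<theta> < pi / 2"
  shows "sector \<theta> = {z. 0 \<le> Re z \<and> \<bar>Im z\<bar> \<le> tan \<theta> * Re z}"
proof (intro equalityI subsetI)
  fix z assume "z \<in> sector \<theta>"
  then obtain r \<alpha> where z: "z = of_real r * cis \<alpha>" "r \<ge> 0" "\<bar>\<alpha>\<bar> \<le> \<theta>"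
    by (auto simp: sector_def)
  have c: "cos \<alpha> > 0" using z assms by (intro cos_gt_zero_pi) auto
  have "tan \<alpha> \<le> tan \<theta>" "tan (-\<alpha>) \<le> tan \<theta>"
    using z assms by (intro tan_mono_le; simp)+
  hence "\<bar>tan \<alpha>\<bar> \<le> tan \<theta>" by simp
  hence "\<bar>sin \<alpha>\<bar> \<le> tan \<theta> * cos \<alpha>"
    using c by (simp add: tan_def field_simps)
  hence "r * \<bar>sin \<alpha>\<bar> \<le> r * (tan \<theta> * cos \<alpha>)"
    using z by (intro mult_left_mono)
  thus "z \<in> {z. 0 \<le> Re z \<and> \<bar>Im z\<bar> \<le> tan \<theta> * Re z}"
    using z c by (simp add: abs_mult mult_ac)
next
  fix z assume z: "z \<in> {z. 0 \<le> Re z \<and> \<bar>Im z\<bar> \<le> tan \<theta> * Re z}"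
  show "z \<in> sector \<theta>"
  proof (cases "z = 0")
    case True
    thus ?thesis using assms unfolding sector_def
      by (intro CollectI exI[of _ 0]) auto
  next
    case False
    have pos: "Re z > 0"
      using z False by (cases "Re z = 0") (auto simp: complex_eq_iff)
    define \<alpha> where "\<alpha> = Arg z"
    have eq: "z = of_real (norm z) * cis \<alpha>"
      using rcis_cmod_Arg[of z] by (simp add: rcis_def \<alpha>_def)
    have \<alpha>: "\<bar>\<alpha>\<bar> < pi / 2"
      using pos Arg_Re_pos[of z] by (simp add: \<alpha>_def)
    have "\<bar>\<alpha>\<bar> \<le> \<theta>"
    proof (rule ccontr)
      assume "\<not> \<bar>\<alpha>\<bar> \<le> \<theta>"
      hence "tan \<theta> < tan \<bar>\<alpha>\<bar>"
        using \<alpha> assms by (intro tan_monotone) auto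
      hence "tan \<theta> * Re z < tan \<bar>\<alpha>\<bar> * Re z" using pos by simp
      also have "tan \<bar>\<alpha>\<bar> * Re z = \<bar>tan \<alpha> * Re z\<bar>"
      proof -
        have "tan \<bar>\<alpha>\<bar> \<ge> 0" using \<alpha> by (cases "\<alpha> = 0") (auto intro!: less_imp_le tan_gt_zero)
        thus ?thesis using pos by (cases "\<alpha> \<ge> 0") (auto simp: abs_mult)
      qed
      also have "tan \<alpha> * Re z = Im z"
      proof -
        have "cos \<alpha> > 0" using \<alpha> by (intro cos_gt_zero_pi) auto
        moreover have "Re z = norm z * cos \<alpha>" "Im z = norm z * sin \<alpha>" by (subst eq, simp)+
        ultimately show ?thesis by (simp add: tan_def)
      qed
      finally show False using z by simp
    qed
    thus ?thesis unfolding sector_def using eq by (intro CollectI exI[of _ "norm z"] exI[of _ \<alpha>]) auto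
  qed
qed

lemma cone_sector: "cone (sector \<theta>)"
  unfolding cone_def
proof safe
  fix z c assume "z \<in> sector \<theta>" "(c::real) \<ge> 0"
  then obtain r \<alpha> where "z = of_real r * cis \<alpha>" "r \<ge> 0" "\<bar>\<alpha>\<bar> \<le> \<theta>" by (auto simp: sector_def)
  thus "c *\<^sub>R z \<in> sector \<theta>" unfolding sector_def using \<open>c \<ge> 0\<close>
    by (intro CollectI exI[of _ "c * r"] exI[of _ \<alpha>]) (auto simp: scaleR_conv_of_real)
qed

lemma sector_scale: "z \<in> sector \<theta> \<Longrightarrow> c \<ge> 0 \<Longrightarrow> of_real c * z \<in> sector \<theta>"
  using cone_sector[of \<theta>] by (auto simp: cone_def scaleR_conv_of_real)

lemma of_real_in_sector: "0 \<le> \<theta> \<Longrightarrow> x \<ge> 0 \<Longrightarrow> of_real x \<in> sector \<theta>"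
  unfolding sector_def by (intro CollectI exI[of _ x] exI[of _ 0]) auto

lemma convex_sector:
  assumes "0 \<le> \<theta>" "\<theta> < pi / 2"
  shows "convex (sector \<theta>)"
proof -
  have "sector \<theta> = {z. 0 \<le> Re z} \<inter> {z. (\<i> - of_real (tan \<theta>)) \<bullet> z \<le> 0} \<inter> {z. (-\<i> - of_real (tan \<theta>)) \<bullet> z \<le> 0}"
    unfolding sector_altdef[OF assms] by (auto simp: inner_complex_def abs_le_iff)
  thus ?thesis by (auto intro!: convex_Int convex_halfspace_le convex_halfspace_Re_ge)
qed

lemma closed_sector:
  assumes "0 \<le> \<theta>" "\<theta> < pi / 2"
  shows "closed (sector \<theta>)"
  unfolding sector_altdef[OF assms] Collect_conj_eq
  by (intro closed_Int closed_Collect_le continuous_intros)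

text \<open>Since \<open>cos \<theta> > 0\<close>, decay in \<open>Re z\<close> is decay in \<open>norm z\<close> on the sector. This is what an opening
angle strictly below \<open>\<pi> / 2\<close> provides.\<close>

lemma Re_sector_ge:
  assumes "0 \<le> \<theta>" "\<theta> < pi / 2" "z \<in> sector \<theta>"
  shows "cos \<theta> * norm z \<le> Re z"
proof -
  from assms obtain r \<alpha> where z: "z = of_real r * cis \<alpha>" "r \<ge> 0" "\<bar>\<alpha>\<bar> \<le> \<theta>"
    by (auto simp: sector_def)
  have "cos \<theta> \<le> cos \<bar>\<alpha>\<bar>" using z assms by (intro cos_monotone_0_pi_le) auto
  thus ?thesis using z by (simp add: norm_mult mult_left_mono mult.commute)
qed

lemma Re_sector_pos:
  assumes "0 \<le> \<theta>" "\<theta> < pi / 2" "z \<in> sector \<theta>" "z \<noteq> 0"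
  shows "Re z > 0"
proof -
  have "0 < cos \<theta> * norm z" using assms cos_gt_zero_pi[of \<theta>] by simp
  also have "\<dots> \<le> Re z" by (rule Re_sector_ge) (use assms in auto)
  finally show ?thesis .
qed

section \<open>Functions of sufficient decay\<close>

text \<open>Replacing \<open>norm z\<close> by \<open>1 + norm z\<close> costs only a constant far from the origin, but it makes the
majorant bounded near the origin, so that it can serve on the whole sector.\<close>

lemma sufficient_decay_iff:
  "sufficient_decay D g \<longleftrightarrow>
     (\<exists>\<epsilon>>0. \<exists>K R. \<forall>z\<in>D. norm z \<ge> R \<longrightarrow> norm (g z) \<le> K * (1 + norm z) powr (-1 - \<epsilon>))"
proof
  assume "sufficient_decay D g"
  then obtain \<epsilon> where e: "\<epsilon> > 0" "(\<lambda>w. norm (g w)) \<in> O[inf at_infinity (principal D)](\<lambda>w. norm w powr (-1 - \<epsilon>))"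
    by (auto simp: sufficient_decay_def)
  from e(2) obtain c where c: "c > 0"
     "eventually (\<lambda>w. norm (g w) \<le> c * norm w powr (-1 - \<epsilon>)) (inf at_infinity (principal D))"
    by (auto elim!: landau_o.bigE)
  then obtain R where R: "\<And>w. w \<in> D \<Longrightarrow> norm w \<ge> R \<Longrightarrow> norm (g w) \<le> c * norm w powr (-1 - \<epsilon>)"
    by (auto simp: eventually_inf_principal eventually_at_infinity)
  have "norm (g z) \<le> c * 2 powr (1 + \<epsilon>) * (1 + norm z) powr (-1 - \<epsilon>)" if "z \<in> D" "norm z \<ge> max 1 R" for z
  proof -
    have "norm (g z) \<le> c * norm z powr (-1 - \<epsilon>)" using R that by auto
    also have "norm z powr (-1 - \<epsilon>) \<le> ((1 + norm z) / 2) powr (-1 - \<epsilon>)"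
      using that e by (intro powr_mono2') (auto simp: add_pos_nonneg)
    also have "\<dots> = 2 powr (1 + \<epsilon>) * (1 + norm z) powr (-1 - \<epsilon>)"
    proof -
      have "2 powr (-1 - \<epsilon>) = 1 / (2::real) powr (1 + \<epsilon>)" using powr_minus_divide[of 2 "1 + \<epsilon>"] by simp
      thus ?thesis by (simp add: powr_divide)
    qed
    finally show ?thesis using c by (simp add: mult_ac)
  qed
  thus "\<exists>\<epsilon>>0. \<exists>K R. \<forall>z\<in>D. norm z \<ge> R \<longrightarrow> norm (g z) \<le> K * (1 + norm z) powr (-1 - \<epsilon>)"
    using e(1) by blast
next
  assume "\<exists>\<epsilon>>0. \<exists>K R. \<forall>z\<in>D. norm z \<ge> R \<longrightarrow> norm (g z) \<le> K * (1 + norm z) powr (-1 - \<epsilon>)"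
  then obtain \<epsilon> K R where e: "\<epsilon> > 0" "\<And>z. z \<in> D \<Longrightarrow> norm z \<ge> R \<Longrightarrow> norm (g z) \<le> K * (1 + norm z) powr (-1 - \<epsilon>)"
    by blast
  have "norm (g z) \<le> (\<bar>K\<bar> + 1) * norm z powr (-1 - \<epsilon>)" if "z \<in> D" "norm z \<ge> max 1 R" for z
  proof -
    have "norm (g z) \<le> K * (1 + norm z) powr (-1 - \<epsilon>)" using that by (intro e) auto
    also have "\<dots> \<le> (\<bar>K\<bar> + 1) * norm z powr (-1 - \<epsilon>)"
      using that e(1) by (intro mult_mono powr_mono2') auto
    finally show ?thesis .
  qed
  hence "eventually (\<lambda>z. norm (norm (g z)) \<le> (\<bar>K\<bar> + 1) * norm (norm z powr (-1 - \<epsilon>))) (inf at_infinity (principal D))"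
    unfolding eventually_inf_principal eventually_at_infinity by (intro exI[of _ "max 1 R"]) auto
  thus "sufficient_decay D g"
    unfolding sufficient_decay_def using e(1) by (intro exI[of _ \<epsilon>] conjI landau_o.bigI[of "\<bar>K\<bar> + 1"]) auto
qed

lemma sufficient_decay_cong:
  assumes "\<And>z. z \<in> D \<Longrightarrow> z \<noteq> 0 \<Longrightarrow> f z = g z"
  shows "sufficient_decay D f \<longleftrightarrow> sufficient_decay D g"
proof -
  have "eventually (\<lambda>z. norm (f z) = norm (g z)) (inf at_infinity (principal D))"
    unfolding eventually_inf_principal eventually_at_infinity
    using assms by (intro exI[of _ 1]) (metis norm_zero not_one_le_zero)
  thus ?thesis unfolding sufficient_decay_def by (simp cong: landau_o.big.in_cong)
qed

lemma sufficient_decay_cmult: "sufficient_decay D g \<Longrightarrow> sufficient_decay D (\<lambda>z. c * g z)"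
  unfolding sufficient_decay_def norm_mult by (cases "c = 0") auto

lemma sufficient_decay_diff:
  assumes "sufficient_decay D f" "sufficient_decay D g"
  shows "sufficient_decay D (\<lambda>z. f z - g z)"
proof -
  from assms(1) obtain \<epsilon> K R where 1: "\<epsilon> > 0" "\<And>z. z \<in> D \<Longrightarrow> norm z \<ge> R \<Longrightarrow> norm (f z) \<le> K * (1 + norm z) powr (-1 - \<epsilon>)"
    unfolding sufficient_decay_iff by blast
  from assms(2) obtain \<epsilon>' K' R' where 2: "\<epsilon>' > 0" "\<And>z. z \<in> D \<Longrightarrow> norm z \<ge> R' \<Longrightarrow> norm (g z) \<le> K' * (1 + norm z) powr (-1 - \<epsilon>')"
    unfolding sufficient_decay_iff by blast
  define \<delta> where "\<delta> = min \<epsilon> \<epsilon>'"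
  have "norm (f z - g z) \<le> (\<bar>K\<bar> + \<bar>K'\<bar>) * (1 + norm z) powr (-1 - \<delta>)" if z: "z \<in> D" "norm z \<ge> max R R'" for z
  proof -
    have "norm (f z - g z) \<le> norm (f z) + norm (g z)" by (rule norm_triangle_ineq4)
    also have "\<dots> \<le> K * (1 + norm z) powr (-1 - \<epsilon>) + K' * (1 + norm z) powr (-1 - \<epsilon>')"
      using z by (intro add_mono 1 2) auto
    also have "\<dots> \<le> \<bar>K\<bar> * (1 + norm z) powr (-1 - \<delta>) + \<bar>K'\<bar> * (1 + norm z) powr (-1 - \<delta>)"
      by (intro add_mono mult_mono powr_mono) (auto simp: \<delta>_def)
    finally show ?thesis by (simp add: algebra_simps)
  qed
  moreover have "\<delta> > 0" using 1 2 by (simp add: \<delta>_def)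
  ultimately show ?thesis unfolding sufficient_decay_iff by blast
qed

lemma sufficient_decay_uniform:
  assumes "sufficient_decay D g" "closed D" "continuous_on D g"
  shows "\<exists>\<epsilon>>0. \<exists>K. \<forall>z\<in>D. norm (g z) \<le> K * (1 + norm z) powr (-1 - \<epsilon>)"
proof -
  from assms(1) obtain \<epsilon> K R where e: "\<epsilon> > 0" "\<And>z. z \<in> D \<Longrightarrow> norm z \<ge> R \<Longrightarrow> norm (g z) \<le> K * (1 + norm z) powr (-1 - \<epsilon>)"
    unfolding sufficient_decay_iff by blast
  have "compact (D \<inter> cball 0 R)" using assms(2) by (intro closed_Int_compact) auto
  hence "bounded (g ` (D \<inter> cball 0 R))"
    using assms(3) by (intro compact_imp_bounded compact_continuous_image) (auto intro: continuous_on_subset)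
  then obtain B where B: "\<And>z. z \<in> D \<Longrightarrow> norm z \<le> R \<Longrightarrow> norm (g z) \<le> B"
    unfolding bounded_iff by (metis IntI imageI mem_cball_0)
  have "norm (g z) \<le> (\<bar>K\<bar> + \<bar>B\<bar> * (1 + R) powr (1 + \<epsilon>)) * (1 + norm z) powr (-1 - \<epsilon>)" if z: "z \<in> D" for z
  proof (cases "norm z \<ge> R")
    case True
    have "norm (g z) \<le> K * (1 + norm z) powr (-1 - \<epsilon>)" using e z True by auto
    also have "\<dots> \<le> (\<bar>K\<bar> + \<bar>B\<bar> * (1 + R) powr (1 + \<epsilon>)) * (1 + norm z) powr (-1 - \<epsilon>)"
      by (intro mult_right_mono) (auto intro: order_trans[OF abs_ge_self])
    finally show ?thesis .
  next
    case False
    hence R: "R > 0" using norm_ge_zero[of z] by linarith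
    have "norm (g z) \<le> \<bar>B\<bar> * 1" using B[OF z] False by auto
    also have "1 = (1 + R) powr (1 + \<epsilon>) * (1 + R) powr (-1 - \<epsilon>)"
      using R by (simp flip: powr_add)
    also have "\<dots> \<le> (1 + R) powr (1 + \<epsilon>) * (1 + norm z) powr (-1 - \<epsilon>)"
      using R False e(1) by (intro mult_left_mono powr_mono2') (auto simp: add_pos_nonneg)
    finally have "norm (g z) \<le> \<bar>B\<bar> * (1 + R) powr (1 + \<epsilon>) * (1 + norm z) powr (-1 - \<epsilon>)"
      by (simp add: mult_left_mono mult.assoc)
    also have "\<dots> \<le> (\<bar>K\<bar> + \<bar>B\<bar> * (1 + R) powr (1 + \<epsilon>)) * (1 + norm z) powr (-1 - \<epsilon>)"
      by (intro mult_right_mono) auto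
    finally show ?thesis .
  qed
  thus ?thesis using e(1) by blast
qed

lemma sufficient_decay_summable:
  assumes "sufficient_decay (sector \<theta>) g" "w \<in> sector \<theta>" "w \<noteq> 0"
  shows "summable (\<lambda>m. g (w * of_real (real m + a)))"
proof -
  from assms(1) obtain \<epsilon> K R where e: "\<epsilon> > 0"
    "\<And>z. z \<in> sector \<theta> \<Longrightarrow> norm z \<ge> R \<Longrightarrow> norm (g z) \<le> K * (1 + norm z) powr (-1 - \<epsilon>)"
    unfolding sufficient_decay_iff by blast
  have lim: "filterlim (\<lambda>m. norm w * (real m + a)) at_top sequentially"
    using assms by real_asymp
  have ev: "eventually (\<lambda>m. norm (g (w * of_real (real m + a))) \<le> K * (1 + norm w * (real m + a)) powr (-1 - \<epsilon>)) sequentially"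
    using filterlim_at_top[THEN iffD1, OF lim, rule_format, of "max R 0"]
  proof eventually_elim
    case (elim m)
    hence pos: "real m + a \<ge> 0" using assms by (simp add: zero_le_mult_iff)
    hence nm: "norm (w * of_real (real m + a)) = norm w * (real m + a)"
      by (simp add: norm_mult del: of_real_add)
    have "w * of_real (real m + a) \<in> sector \<theta>"
      using sector_scale[OF assms(2) pos] by (simp add: mult.commute)
    from e(2)[OF this] show ?case using elim unfolding nm by simp
  qed
  have "summable (\<lambda>m. (1 + norm w * (real m + a)) powr (-1 - \<epsilon>))"
  proof (rule summable_comparison_test_bigo)
    show "summable (\<lambda>m. norm (real m powr (-1 - \<epsilon>)))"
      using e(1) by (simp add: summable_real_powr_iff)
    show "(\<lambda>m. (1 + norm w * (real m + a)) powr (-1 - \<epsilon>)) \<in> O(\<lambda>m. real m powr (-1 - \<epsilon>))"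
      using assms(3) e(1) by real_asymp
  qed
  hence "summable (\<lambda>m. K * (1 + norm w * (real m + a)) powr (-1 - \<epsilon>))"
    by (rule summable_mult)
  thus ?thesis using ev by (rule summable_comparison_test_ev[rotated])
qed

lemma sufficient_decay_exp_poly:
  assumes "0 \<le> \<theta>" "\<theta> < pi / 2"
  shows "sufficient_decay (sector \<theta>) (\<lambda>z. exp (-z) * poly p (1 / z))"
proof -
  define c where "c = cos \<theta>"
  have c: "c > 0" using assms unfolding c_def by (intro cos_gt_zero_pi) auto
  have "bounded (poly p ` cball 0 1)"
    by (intro compact_imp_bounded compact_continuous_image continuous_intros) auto
  then obtain B where B: "\<And>z. norm z \<le> 1 \<Longrightarrow> norm (poly p z) \<le> B"
    unfolding bounded_iff by (metis imageI mem_cball_0)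
  have "eventually (\<lambda>x::real. exp (-(c * x)) \<le> (1 + x) powr (-1 - 1)) at_top"
    using c by real_asymp
  then obtain R where R: "\<And>x. x \<ge> R \<Longrightarrow> exp (-(c * x)) \<le> (1 + x) powr (-1 - 1)"
    by (auto simp: eventually_at_top_linorder)
  have "norm (exp (-z) * poly p (1 / z)) \<le> \<bar>B\<bar> * (1 + norm z) powr (-1 - 1)"
    if z: "z \<in> sector \<theta>" "norm z \<ge> max 1 R" for z
  proof -
    have "norm (exp (-z)) = exp (- Re z)" by simp
    also have "\<dots> \<le> exp (- (c * norm z))" using Re_sector_ge[OF assms z(1)] by (simp add: c_def)
    also have "\<dots> \<le> (1 + norm z) powr (-1 - 1)" using R z by auto
    finally have 1: "norm (exp (-z)) \<le> (1 + norm z) powr (-1 - 1)" .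
    have 2: "norm (poly p (1 / z)) \<le> \<bar>B\<bar>"
      using z by (intro order_trans[OF B]) (auto simp: norm_divide divide_le_eq_1)
    have "norm (exp (-z)) * norm (poly p (1 / z)) \<le> (1 + norm z) powr (-1 - 1) * \<bar>B\<bar>"
      by (intro mult_mono 1 2) auto
    thus ?thesis unfolding norm_mult by (simp only: mult_ac)
  qed
  moreover have "(0::real) < 1" by simp
  ultimately show ?thesis unfolding sufficient_decay_iff by blast
qed

text \<open>Functions of the form \<open>exp (- z) * p (1 / z)\<close> are closed under differentiation. Hence every
derivative of \<open>exp (- z) / z\<close> is covered by the preceding decay lemma.\<close>

lemma higher_deriv_exp_poly:
  "\<exists>q. \<forall>z. z \<noteq> 0 \<longrightarrow> (deriv ^^ n) (\<lambda>z::complex. exp (-z) * poly p (1 / z)) z = exp (-z) * poly q (1 / z)"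
proof (induction n)
  case 0
  show ?case by auto
next
  case (Suc n)
  then obtain q where q: "\<And>z. z \<noteq> 0 \<Longrightarrow> (deriv ^^ n) (\<lambda>z::complex. exp (-z) * poly p (1 / z)) z = exp (-z) * poly q (1 / z)"
    by blast
  have "(deriv ^^ Suc n) (\<lambda>z::complex. exp (-z) * poly p (1 / z)) z
      = exp (-z) * poly (- q - [:0, 0, 1:] * pderiv q) (1 / z)" if z: "z \<noteq> 0" for z
  proof -
    have "(deriv ^^ Suc n) (\<lambda>z::complex. exp (-z) * poly p (1 / z)) z = deriv (\<lambda>z. exp (-z) * poly q (1 / z)) z"
      unfolding funpow.simps o_def
    proof (rule deriv_cong_ev)
      show "eventually (\<lambda>z. (deriv ^^ n) (\<lambda>z::complex. exp (-z) * poly p (1 / z)) z = exp (-z) * poly q (1 / z)) (nhds z)"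
        using t1_space_nhds[OF z] by eventually_elim (use q in auto)
    qed auto
    also have "\<dots> = exp (-z) * poly (- q - [:0, 0, 1:] * pderiv q) (1 / z)"
      using z by (intro DERIV_imp_deriv)
        (auto intro!: derivative_eq_intros simp: field_simps power2_eq_square)
    finally show ?thesis .
  qed
  thus ?case by blast
qed

section \<open>The model pole\<close>

lemma summable_inverse_shift_mult:
  fixes a :: real
  shows "summable (\<lambda>m. 1 / ((real m + a) * (real m + 1)))"
proof (rule summable_comparison_test_bigo)
  show "summable (\<lambda>m. norm (real m powr (-2)))"
    by (simp add: summable_real_powr_iff)
  show "(\<lambda>m. 1 / ((real m + a) * (real m + 1))) \<in> O(\<lambda>m. real m powr (-2))"
    by real_asymp
qed

lemma inverse_shift_diff:
  fixes a :: real
  assumes "a \<notin> \<int>\<^sub>\<le>\<^sub>0"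
  shows "1 / (real m + a) - 1 / (real m + 1) = (1 - a) * (1 / ((real m + a) * (real m + 1)))"
proof -
  have "real m + a \<noteq> 0"
    using assms plus_of_nat_eq_0_imp[of a m] by (auto simp: add.commute)
  thus ?thesis by (simp add: field_simps)
qed

text \<open>By partial fractions the constant is \<open>- \<psi>(a) - \<gamma>\<close>, with \<open>\<psi>\<close> the digamma function.\<close>

lemma C_const_sums:
  assumes "a \<notin> \<int>\<^sub>\<le>\<^sub>0"
  shows "(\<lambda>m. 1 / (real m + a) - 1 / (real m + 1)) sums C_const a"
  unfolding C_const_def inverse_shift_diff[OF assms]
  by (intro sums_mult summable_sums summable_inverse_shift_mult)

lemma C_const_plus1:
  assumes "a \<notin> \<int>\<^sub>\<le>\<^sub>0"
  shows "C_const a = C_const (a + 1) + 1 / a"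
proof -
  have a1: "a + 1 \<notin> \<int>\<^sub>\<le>\<^sub>0"
    using assms plus_one_in_nonpos_Ints_imp by blast
  have "(\<lambda>m. 1 / (real m + a) - 1 / (real (Suc m) + a)) sums (1 / (real 0 + a) - 0)"
    by (rule telescope_sums') real_asymp
  from sums_add[OF C_const_sums[OF a1] this]
  have "(\<lambda>m. 1 / (real m + a) - 1 / (real m + 1)) sums (C_const (a + 1) + 1 / a)"
    by (simp add: add_ac)
  thus ?thesis using C_const_sums[OF assms] sums_unique2 by blast
qed

text \<open>Up to the factor \<open>1 / w\<close>, this is the sum of \<open>exp (- z) / z\<close> over \<open>z = w * (m + a)\<close>.\<close>

definition damped_harmonic :: "real \<Rightarrow> complex \<Rightarrow> complex" where
  "damped_harmonic a w = (\<Sum>m. exp (- (w * of_real (real m + a))) / of_real (real m + a))"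

lemma summable_exp_arith:
  assumes "Re w > 0"
  shows "summable (\<lambda>m. norm (exp (- (w * of_real (real m + a)))))"
proof -
  have "norm (exp (- (w * of_real (real m + a)))) = exp (- Re w * a) * exp (- Re w) ^ m" for m
    by (simp add: exp_add [symmetric] exp_of_nat_mult [symmetric] algebra_simps)
  moreover have "summable (\<lambda>m. exp (- Re w * a) * exp (- Re w) ^ m)"
    using assms by (intro summable_mult summable_geometric) auto
  ultimately show ?thesis by simp
qed

lemma summable_damped_harmonic:
  assumes "Re w > 0" "a > 0"
  shows "summable (\<lambda>m. exp (- (w * of_real (real m + a))) / of_real (real m + a))"
proof (rule summable_comparison_test)
  show "summable (\<lambda>m. norm (exp (- (w * of_real (real m + a)))) / a)"
    by (intro summable_divide summable_exp_arith assms)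
  have "norm (exp (- (w * of_real (real m + a))) / of_real (real m + a)) \<le> norm (exp (- (w * of_real (real m + a)))) / a" for m
    unfolding norm_divide norm_of_real using assms by (intro divide_left_mono) auto
  thus "\<exists>N. \<forall>n\<ge>N. norm (exp (- (w * of_real (real n + a))) / of_real (real n + a))
           \<le> norm (exp (- (w * of_real (real n + a)))) / a" by blast
qed

lemma damped_harmonic_has_field_derivative:
  assumes "Re w > 0" "a > 0"
  shows "(damped_harmonic a has_field_derivative - (\<Sum>m. exp (- (w * of_real (real m + a))))) (at w)"
proof -
  let ?c = "Re w / 2"
  let ?H = "{z. Re z > ?c}"
  have "((\<lambda>w. \<Sum>m. exp (- (w * of_real (real m + a))) / of_real (real m + a))
          has_field_derivative (\<Sum>m. - exp (- (w * of_real (real m + a))))) (at w)"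
  proof (rule has_field_derivative_series')
    show "convex ?H" by (rule convex_halfspace_Re_gt)
    show "w \<in> ?H" using assms by simp
    have "open ?H" by (rule open_halfspace_Re_gt)
    thus "w \<in> interior ?H" using assms by (simp add: interior_open)
    show "summable (\<lambda>m. exp (- (w * of_real (real m + a))) / of_real (real m + a))"
      by (intro summable_damped_harmonic assms)
    show "((\<lambda>x. exp (- (x * of_real (real m + a))) / of_real (real m + a)) has_field_derivative
            - exp (- (x * of_real (real m + a)))) (at x within ?H)" for m x
    proof -
      have "complex_of_real (real m + a) \<noteq> 0" using assms by (simp add: of_real_eq_0_iff del: of_real_add)
      thus ?thesis by (auto intro!: derivative_eq_intros simp del: of_real_add)
    qed
    show "uniformly_convergent_on ?H (\<lambda>n x. \<Sum>m<n. - exp (- (x * of_real (real m + a))))"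
    proof (rule Weierstrass_m_test')
      show "summable (\<lambda>m. norm (exp (- (complex_of_real ?c * of_real (real m + a)))))"
        using assms by (intro summable_exp_arith) auto
      show "norm (- exp (- (x * of_real (real m + a)))) \<le> norm (exp (- (complex_of_real ?c * of_real (real m + a))))"
        if "x \<in> ?H" for m x
      proof -
        have "?c * (real m + a) \<le> Re x * (real m + a)"
          using that assms by (intro mult_right_mono) auto
        thus ?thesis by simp
      qed
    qed
  qed
  also have "(\<Sum>m. - exp (- (w * of_real (real m + a)))) = - (\<Sum>m. exp (- (w * of_real (real m + a))))"
    using summable_exp_arith[OF assms(1)] by (intro suminf_minus) (rule summable_norm_cancel)
  finally show ?thesis unfolding damped_harmonic_def [abs_def] .
qed

text \<open>For \<open>a = 1\<close> the series is \<open>- ln (1 - exp (- t))\<close>. In general one compares \<open>1 / (m + a)\<close> with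
\<open>1 / (m + 1)\<close>: the differences are absolutely summable and add up to the constant, and Tannery's
theorem removes the damping factor \<open>exp (- t * m)\<close> in the limit.\<close>

lemma damped_harmonic_real_limit:
  assumes a: "a > 0"
  shows "((\<lambda>t. damped_harmonic a (of_real t) + of_real (ln t)) \<longlongrightarrow> of_real (C_const a)) (at_right 0)"
proof -
  have a': "a \<notin> \<int>\<^sub>\<le>\<^sub>0" using a nonpos_Ints_nonpos by force
  define c where "c = (\<lambda>m. 1 / (real m + a) - 1 / (real m + 1))"
  have abs: "summable (\<lambda>m. norm (c m))"
  proof -
    have "norm (c m) = \<bar>1 - a\<bar> * (1 / ((real m + a) * (real m + 1)))" for m
      using a unfolding c_def inverse_shift_diff[OF a'] by (simp add: abs_mult)
    thus ?thesis using summable_mult[OF summable_inverse_shift_mult] by simp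
  qed
  have lim: "((\<lambda>t. \<Sum>m. exp (- t * real m) * c m) \<longlongrightarrow> (\<Sum>m. exp (- 0 * real m) * c m)) (at_right 0)"
  proof (rule tannerys_theorem[THEN conjunct2, THEN conjunct2])
    show "((\<lambda>t. exp (- t * real m) * c m) \<longlongrightarrow> exp (- 0 * real m) * c m) (at_right 0)" for m
      by (intro tendsto_intros)
    have "eventually (\<lambda>t::real. t > 0) (at_right 0)" by (simp add: eventually_at_right_less)
    hence "eventually (\<lambda>t::real. \<forall>m. norm (exp (- t * real m) * c m) \<le> norm (c m)) (at_right 0)"
      by eventually_elim (auto simp: abs_mult intro!: mult_left_le_one_le)
    thus "eventually (\<lambda>(m, t). norm (exp (- t * real m) * c m) \<le> norm (c m)) (at_top \<times>\<^sub>F at_right 0)"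
      unfolding eventually_prod_filter
      by (intro exI[of _ "\<lambda>_. True"] exI[of _ "\<lambda>t. \<forall>m. norm (exp (- t * real m) * c m) \<le> norm (c m)"]) auto
  qed (use abs in auto)
  have eq: "damped_harmonic a (of_real t) =
      of_real (exp (- t * a) * ((\<Sum>m. exp (- t * real m) * c m) - exp t * ln (1 - exp (- t))))"
    if t: "t > 0" for t
  proof -
    have "(\<lambda>n. - ((exp (- t)) ^ n) / of_nat n) sums ln (1 - exp (- t))"
      using ln_series'[of "- exp (- t)"] t by simp
    hence "(\<lambda>n. - ((exp (- t)) ^ Suc n) / of_nat (Suc n)) sums ln (1 - exp (- t))"
      by (subst sums_Suc_iff) simp
    from sums_mult[OF this, of "- exp t"]
    have 1: "(\<lambda>m. exp (- t * real m) / (real m + 1)) sums (- exp t * ln (1 - exp (- t)))"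
    proof -
      have "- exp t * (- (exp (- t) ^ Suc n) / real (Suc n)) = exp (- t * real n) / (real n + 1)" for n
      proof -
        have "exp t * exp (- t) ^ Suc n = exp (- t) ^ n" by (simp add: exp_minus)
        also have "\<dots> = exp (- t * real n)" by (simp add: exp_of_nat_mult[symmetric] mult.commute)
        finally have *: "exp t * exp (- t) ^ Suc n = exp (- t * real n)" .
        have "- exp t * (- (exp (- t) ^ Suc n) / real (Suc n)) = exp t * exp (- t) ^ Suc n / real (Suc n)" by simp
        thus ?thesis unfolding * by (simp add: add.commute)
      qed
      thus "(\<lambda>n. - exp t * (- (exp (- t) ^ Suc n) / real (Suc n))) sums (- exp t * ln (1 - exp (- t))) \<Longrightarrow> ?thesis"
        by simp
    qed
    have "summable (\<lambda>m. exp (- t * real m) * c m)"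
      using t abs by (intro summable_comparison_test'[OF abs]) (auto simp: abs_mult intro!: mult_left_le_one_le)
    hence "(\<lambda>m. exp (- t * real m) * c m) sums (\<Sum>m. exp (- t * real m) * c m)"
      by (rule summable_sums)
    from sums_mult[OF sums_add[OF this 1], of "exp (- t * a)"]
    have "(\<lambda>m. exp (- t * a) * (exp (- t * real m) / (real m + a))) sums
        (exp (- t * a) * ((\<Sum>m. exp (- t * real m) * c m) - exp t * ln (1 - exp (- t))))"
      by (simp add: c_def algebra_simps)
    also have "(\<lambda>m. exp (- t * a) * (exp (- t * real m) / (real m + a))) = (\<lambda>m. exp (- (t * (real m + a))) / (real m + a))"
      by (simp add: algebra_simps flip: exp_add)
    finally have "(\<lambda>m. complex_of_real (exp (- (t * (real m + a))) / (real m + a))) sums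
        of_real (exp (- t * a) * ((\<Sum>m. exp (- t * real m) * c m) - exp t * ln (1 - exp (- t))))"
      by (subst sums_of_real_iff)
    thus ?thesis unfolding damped_harmonic_def
      by (intro sums_unique[symmetric]) (simp add: exp_of_real[symmetric])
  qed
  have "((\<lambda>t. ln t - exp (- t * a) * exp t * ln (1 - exp (- t))) \<longlongrightarrow> 0) (at_right (0::real))"
    by real_asymp
  moreover have "((\<lambda>t. exp (- t * a)) \<longlongrightarrow> exp (- 0 * a)) (at_right (0::real))"
    by (intro tendsto_intros)
  ultimately have "((\<lambda>t. exp (- t * a) * (\<Sum>m. exp (- t * real m) * c m) + (ln t - exp (- t * a) * exp t * ln (1 - exp (- t))))
      \<longlongrightarrow> exp (- 0 * a) * (\<Sum>m. exp (- 0 * real m) * c m) + 0) (at_right 0)"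
    by (intro tendsto_add tendsto_mult lim)
  also have "exp (- 0 * a) * (\<Sum>m. exp (- 0 * real m) * c m) + 0 = C_const a"
    using C_const_sums[OF a'] by (simp add: c_def sums_iff)
  finally have "((\<lambda>t. complex_of_real (exp (- t * a) * (\<Sum>m. exp (- t * real m) * c m) + (ln t - exp (- t * a) * exp t * ln (1 - exp (- t)))))
      \<longlongrightarrow> of_real (C_const a)) (at_right 0)"
    by (rule tendsto_of_real)
  thus ?thesis
  proof (rule Lim_transform_eventually)
    have "eventually (\<lambda>t::real. t > 0) (at_right 0)" by (simp add: eventually_at_right_less)
    thus "eventually (\<lambda>t. complex_of_real (exp (- t * a) * (\<Sum>m. exp (- t * real m) * c m) + (ln t - exp (- t * a) * exp t * ln (1 - exp (- t))))
       = damped_harmonic a (of_real t) + of_real (ln t)) (at_right 0)"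
      by eventually_elim (simp only: eq, simp add: algebra_simps)
  qed
qed

text \<open>Differentiating the series removes the denominators \<open>m + a\<close> and leaves the sum of
\<open>exp (- w * (m + a))\<close>, to which Euler--Maclaurin applies. Its leading term \<open>1 / w\<close> is the derivative
of \<open>Ln w\<close>, so integrating back from \<open>0\<close> gives the logarithm and the polynomial \<open>P\<close>; the constant
of integration comes from the limit along the positive reals. Integration is done by the mean
value inequality on the convex set of nonzero points of the sector with norm at most \<open>norm w\<close>.\<close>

lemma damped_harmonic_asymptotics:
  fixes N :: nat
  assumes \<theta>: "0 \<le> \<theta>" "\<theta> < pi / 2" and a: "a > 0"
  defines "P \<equiv> \<lambda>w. \<Sum>n<N. of_real (bernoulli_poly (Suc n) a / (fact (Suc n) * real (Suc n)) * (-1) ^ n) * w ^ Suc n"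
  shows "\<exists>K. \<forall>w\<in>sector \<theta> - {0}. norm w \<le> 1 \<longrightarrow>
           norm (damped_harmonic a w + Ln w - of_real (C_const a) - P w) \<le> K * norm w ^ Suc N"
proof -
  \<comment> \<open>\<open>D 0 = - exp (- z)\<close> is the antiderivative of \<open>exp (- z)\<close> that vanishes at infinity.\<close>
  define D :: "nat \<Rightarrow> complex \<Rightarrow> complex" where "D = (\<lambda>n z. (-1) ^ Suc n * exp (- z))"
  define \<beta> where "\<beta> n = bernoulli_poly n a / fact n" for n
  define L where "L w = (\<Sum>m. exp (- (w * of_real (real m + a))))" for w :: complex
  have decay: "sufficient_decay (sector \<theta>) (\<lambda>z. exp (- z))"
    using sufficient_decay_exp_poly[OF \<theta>, of 1] by simp
  have "\<exists>\<epsilon>>0. \<exists>K. \<forall>z\<in>sector \<theta>. norm (exp (- z)) \<le> K * (1 + norm z) powr (-1 - \<epsilon>)"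
    by (intro sufficient_decay_uniform decay closed_sector \<theta> continuous_intros)
  then obtain \<epsilon> K where e: "\<epsilon> > 0" "\<And>z. z \<in> sector \<theta> \<Longrightarrow> norm (exp (- z)) \<le> K * (1 + norm z) powr (-1 - \<epsilon>)"
    by blast
  define K' where "K' = ((\<Sum>n\<le>N. \<bar>\<beta> n\<bar>) + \<bar>a\<bar> ^ (N + 1)) * K * (1 + 1 / \<epsilon>)"
  have EM: "norm (w * L w + (\<Sum>n\<le>N. of_real (\<beta> n) * w ^ n * (-1) ^ Suc n)) \<le> K' * norm w ^ (N + 1)"
    if w: "w \<in> sector \<theta>" "w \<noteq> 0" "norm w \<le> 1" for w
  proof -
    have "norm (w * (\<Sum>m. D 1 (w * of_real (real m + a)))
                 + (\<Sum>n\<le>N. of_real (bernoulli_poly n a / fact n) * w ^ n * D n 0))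
         \<le> ((\<Sum>n\<le>N. \<bar>bernoulli_poly n a / fact n\<bar>) + \<bar>a\<bar> ^ (N + 1)) * K * (1 + 1 / \<epsilon>) * norm w ^ (N + 1)"
    proof (rule euler_maclaurin_cone[OF convex_sector[OF \<theta>] cone_sector w a e(1)])
      show "(D n has_field_derivative D (Suc n) z) (at z within sector \<theta>)" for n z
        unfolding D_def by (auto intro!: derivative_eq_intros)
      show "norm (D (N + 2) z) \<le> K * (1 + norm z) powr (-1 - \<epsilon>)" if "z \<in> sector \<theta>" for z
        using e(2)[OF that] by (simp add: D_def norm_mult norm_power)
      show "summable (\<lambda>m. D 1 (w * of_real (real m + a)))"
        using sufficient_decay_summable[OF decay w(1,2), of a] by (simp add: D_def)
      have "(\<lambda>m. exp (- (w * of_real (real m + 0)))) \<longlonglongrightarrow> 0"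
        by (intro summable_LIMSEQ_zero sufficient_decay_summable[OF decay w(1,2)])
      from tendsto_mult_left[OF this, of "(-1) ^ Suc n" for n]
      show "(\<lambda>m. D n (of_nat m * w)) \<longlonglongrightarrow> 0" for n
        by (simp add: D_def mult.commute)
    qed
    thus ?thesis by (simp add: D_def L_def K'_def \<beta>_def)
  qed
  define P' where "P' w = (\<Sum>n<N. of_real (\<beta> (Suc n) * (-1) ^ n) * w ^ n)" for w :: complex
  have P: "(P has_field_derivative P' w) (at w within X)" for w X
    unfolding P_def P'_def
  proof (rule DERIV_sum)
    fix n
    let ?c = "bernoulli_poly (Suc n) a / (fact (Suc n) * real (Suc n)) * (-1) ^ n"
    have "((\<lambda>w. of_real ?c * w ^ Suc n) has_field_derivative of_real ?c * (of_nat (Suc n) * w ^ n)) (at w within X)"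
      by (intro DERIV_cmult DERIV_cong[OF DERIV_power[OF DERIV_ident]]) simp
    also have "of_real ?c * (of_nat (Suc n) * w ^ n) = of_real (?c * real (Suc n)) * w ^ n"
      by (simp only: of_real_mult of_real_of_nat_eq mult_ac)
    also have "?c * real (Suc n) = \<beta> (Suc n) * (-1) ^ n"
      unfolding \<beta>_def by (simp del: fact_Suc of_nat_Suc)
    finally show "((\<lambda>w. of_real ?c * w ^ Suc n) has_field_derivative of_real (\<beta> (Suc n) * (-1) ^ n) * w ^ n) (at w within X)" .
  qed
  define E where "E w = damped_harmonic a w + Ln w - P w" for w
  have E': "(E has_field_derivative (- L w + 1 / w - P' w)) (at w within X)" if w: "w \<in> sector \<theta>" "w \<noteq> 0" for w X
  proof -
    have Re: "Re w > 0" using Re_sector_pos[OF \<theta> w] .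
    hence "w \<notin> \<real>\<^sub>\<le>\<^sub>0" by (auto simp: complex_nonpos_Reals_iff)
    thus ?thesis unfolding E_def [abs_def]
      using has_field_derivative_at_within[OF damped_harmonic_has_field_derivative[OF Re a]] P
      by (auto intro!: derivative_eq_intros simp: L_def divide_inverse)
  qed
  have bound: "norm (- L w + 1 / w - P' w) \<le> K' * norm w ^ N" if w: "w \<in> sector \<theta>" "w \<noteq> 0" "norm w \<le> 1" for w
  proof -
    have "w * L w + (\<Sum>n\<le>N. of_real (\<beta> n) * w ^ n * (-1) ^ Suc n) = w * (L w - 1 / w + P' w)"
    proof -
      have "(\<Sum>n\<le>N. of_real (\<beta> n) * w ^ n * (-1) ^ Suc n) = - 1 + w * P' w"
        unfolding P'_def lessThan_Suc_atMost [symmetric] sum_distrib_left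
        by (subst sum.lessThan_Suc_shift) (simp add: \<beta>_def mult_ac)
      thus ?thesis using w by (simp add: algebra_simps)
    qed
    hence "norm w * norm (L w - 1 / w + P' w) \<le> norm w * (K' * norm w ^ N)"
      using EM[OF w] by (simp only: norm_mult) (simp add: mult_ac)
    hence "norm (L w - 1 / w + P' w) \<le> K' * norm w ^ N" using w by simp
    also have "norm (L w - 1 / w + P' w) = norm (- (L w - 1 / w + P' w))" by (rule norm_minus_cancel [symmetric])
    finally show ?thesis by (simp add: algebra_simps)
  qed
  have K'0: "K' \<ge> 0"
    using EM[of 1] of_real_in_sector[of \<theta> 1] \<theta> by (auto intro: order_trans[OF norm_ge_zero])
  have "norm (E w - of_real (C_const a)) \<le> K' * norm w ^ Suc N"
    if w: "w \<in> sector \<theta>" "w \<noteq> 0" "norm w \<le> 1" for w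
  proof -
    define X where "X = sector \<theta> \<inter> {z. Re z > 0} \<inter> cball 0 (norm w)"
    have convX: "convex X"
      unfolding X_def by (intro convex_Int convex_sector \<theta> convex_halfspace_Re_gt convex_cball)
    have wX: "w \<in> X" using w Re_sector_pos[OF \<theta>] by (auto simp: X_def)
    have diff: "norm (E w - E v) \<le> (K' * norm w ^ N) * norm (w - v)" if v: "v \<in> X" for v
    proof (rule field_differentiable_bound[OF convX _ _ wX v])
      fix z assume z: "z \<in> X"
      hence z': "z \<in> sector \<theta>" "z \<noteq> 0" "norm z \<le> 1" "norm z \<le> norm w" using w by (auto simp: X_def)
      show "(E has_field_derivative (- L z + 1 / z - P' z)) (at z within X)" using E' z' by blast
      have "norm (- L z + 1 / z - P' z) \<le> K' * norm z ^ N" using bound z' by blast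
      also have "\<dots> \<le> K' * norm w ^ N" using z' K'0 by (intro mult_left_mono power_mono) auto
      finally show "norm (- L z + 1 / z - P' z) \<le> K' * norm w ^ N" .
    qed
    have "((\<lambda>t. P (of_real t)) \<longlongrightarrow> P (of_real 0)) (at_right 0)"
      unfolding P_def by (intro tendsto_intros)
    hence "((\<lambda>t. norm (E w - (damped_harmonic a (of_real t) + of_real (ln t) - P (of_real t))))
             \<longlongrightarrow> norm (E w - (of_real (C_const a) - P (of_real 0)))) (at_right 0)"
      by (intro tendsto_intros damped_harmonic_real_limit a)
    moreover have "((\<lambda>t. (K' * norm w ^ N) * norm (w - of_real t)) \<longlongrightarrow> (K' * norm w ^ N) * norm (w - of_real 0)) (at_right 0)"
      by (intro tendsto_intros)
    moreover have ev: "eventually (\<lambda>t. t \<in> {0<..<norm w}) (at_right 0)"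
      using w by (intro eventually_at_right_real) auto
    moreover have "eventually (\<lambda>t::real. norm (E w - (damped_harmonic a (of_real t) + of_real (ln t) - P (of_real t)))
              \<le> (K' * norm w ^ N) * norm (w - of_real t)) (at_right 0)"
      using ev
    proof eventually_elim
      case (elim t)
      have "of_real t \<in> X" using elim of_real_in_sector[of \<theta> t] \<theta> by (auto simp: X_def)
      from diff[OF this] show ?case using elim by (simp add: E_def Ln_of_real)
    qed
    ultimately have "norm (E w - (of_real (C_const a) - P (of_real 0))) \<le> (K' * norm w ^ N) * norm (w - of_real 0)"
      by (intro tendsto_le[where F = "at_right (0::real)"]) auto
    thus ?thesis by (simp add: P_def mult_ac)
  qed
  thus ?thesis unfolding E_def by (intro exI[of _ K']) (auto simp: algebra_simps)
qed

section \<open>Holomorphic summands\<close>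

text \<open>The points seen from \<open>0\<close> inside \<open>S\<close> form an open set that is starlike about \<open>0\<close> when \<open>0 \<in> S\<close>. It
still contains every cone that lies in \<open>S\<close>. In the complex plane, holomorphic functions have primitives on
it, whereas \<open>S\<close> itself need not be simply connected.\<close>

lemma open_segment_hull:
  fixes S :: "'a :: real_normed_vector set"
  assumes "open S"
  shows "open {z. closed_segment 0 z \<subseteq> S}"
proof (rule openI)
  fix z assume "z \<in> {z. closed_segment 0 z \<subseteq> S}"
  then obtain e where e: "e > 0" "(\<Union>x\<in>closed_segment 0 z. ball x e) \<subseteq> S"
    using compact_subset_open_imp_ball_epsilon_subset[of "closed_segment 0 z" S] assms by auto
  have "closed_segment 0 y \<subseteq> S" if y: "y \<in> ball z e" for y
  proof
    fix x assume "x \<in> closed_segment 0 y"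
    then obtain u where u: "0 \<le> u" "u \<le> 1" "x = u *\<^sub>R y" by (auto simp: closed_segment_def)
    have "u *\<^sub>R z \<in> closed_segment 0 z" using u by (auto simp: closed_segment_def)
    moreover have "dist (u *\<^sub>R z) (u *\<^sub>R y) = u * dist z y"
      using u by (simp add: dist_norm scaleR_diff_right [symmetric])
    hence "dist (u *\<^sub>R z) x < e" using y u mult_left_le_one_le[of "dist z y" u] by auto
    ultimately have "x \<in> (\<Union>x\<in>closed_segment 0 z. ball x e)"
      by (intro UN_I[of "u *\<^sub>R z"]) auto
    thus "x \<in> S" using e(2) by blast
  qed
  thus "\<exists>e>0. ball z e \<subseteq> {z. closed_segment 0 z \<subseteq> S}" using e(1) by blast
qed

lemma set_integrable_powr_at_infinity:
  fixes \<epsilon> :: real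
  assumes "\<epsilon> > 0"
  shows "set_integrable lborel {0<..} (\<lambda>x::real. (1 + x) powr (-1 - \<epsilon>))"
proof -
  have "set_integrable lborel (einterval 0 \<infinity>) (\<lambda>x::real. (1 + x) powr (-1 - \<epsilon>))"
  proof (rule interval_integral_FTC_nonneg)
    show "((\<lambda>x. - ((1 + x) powr (-\<epsilon>) / \<epsilon>)) has_real_derivative ((1 + x) powr (-1 - \<epsilon>))) (at x)"
      if "0 < ereal x" "ereal x < \<infinity>" for x
    proof -
      have "((\<lambda>x. (1 + x) powr (-\<epsilon>)) has_real_derivative (-\<epsilon>) * (1 + x) powr (-\<epsilon> - of_nat 1) * 1) (at x)"
        using that by (intro DERIV_fun_powr) (auto intro!: derivative_eq_intros)
      from DERIV_minus[OF DERIV_cdivide[OF this, of \<epsilon>]] show ?thesis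
        using assms by (simp add: minus_diff_commute)
    qed
    show "isCont (\<lambda>x. (1 + x) powr (-1 - \<epsilon>)) x" if "0 < ereal x" "ereal x < \<infinity>" for x
      using that by (auto intro!: continuous_intros)
    show "(((\<lambda>x. - ((1 + x) powr (-\<epsilon>) / \<epsilon>)) \<circ> real_of_ereal) \<longlongrightarrow> - ((1 + 0) powr (-\<epsilon>) / \<epsilon>)) (at_right 0)"
      unfolding zero_ereal_def ereal_tendsto_simps using assms by (auto intro!: tendsto_eq_intros)
    show "(((\<lambda>x. - ((1 + x) powr (-\<epsilon>) / \<epsilon>)) \<circ> real_of_ereal) \<longlongrightarrow> 0) (at_left \<infinity>)"
      unfolding ereal_tendsto_simps using assms by real_asymp
  qed auto
  also have "einterval 0 \<infinity> = {0::real<..}" by (auto simp: einterval_def)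
  finally show ?thesis .
qed

text \<open>This lemma replaces the rotation of a contour: the antiderivative that vanishes at infinity along
the positive reals vanishes along every ray of the sector. Indeed the points \<open>m * w\<close> and
\<open>m * norm w\<close> are joined by a segment of length \<open>O(m)\<close> in the sector whose points have norm at least
a constant times \<open>m\<close>, so the antiderivative changes by \<open>O(m powr (-\<epsilon>))\<close> along it. That is why the
integral in the expansion is over the positive reals for every direction of \<open>w\<close>.\<close>

lemma decaying_primitive:
  assumes \<theta>: "0 \<le> \<theta>" "\<theta> < pi / 2" and S: "open S" "sector \<theta> \<subseteq> S"
    and g: "g holomorphic_on S" and decay: "sufficient_decay (sector \<theta>) g"
  shows "set_integrable lborel {0<..} (\<lambda>x::real. g (of_real x))"
    and "\<exists>G. (\<forall>z\<in>sector \<theta>. (G has_field_derivative g z) (at z)) \<and>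
             (\<forall>w\<in>sector \<theta> - {0}. (\<lambda>m. G (of_nat m * w)) \<longlonglongrightarrow> 0) \<and>
             G 0 = - (LBINT x:{0<..}. g (of_real x))"
proof -
  have cont: "continuous_on (sector \<theta>) g"
    using g S by (meson continuous_on_subset holomorphic_on_imp_continuous_on)
  obtain \<epsilon> K where e: "\<epsilon> > 0" "\<And>z. z \<in> sector \<theta> \<Longrightarrow> norm (g z) \<le> K * (1 + norm z) powr (-1 - \<epsilon>)"
    using sufficient_decay_uniform[OF decay closed_sector[OF \<theta>] cont] by blast
  have cont': "continuous_on {0..} (\<lambda>x::real. g (of_real x))"
    using of_real_in_sector \<theta> by (intro continuous_on_compose2[OF cont] continuous_intros) auto
  have int: "set_integrable lborel {0<..} (\<lambda>x::real. g (of_real x))"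
  proof (rule set_integrable_bound)
    show "set_integrable lborel {0<..} (\<lambda>x::real. K * (1 + x) powr (-1 - \<epsilon>))"
      using set_integrable_powr_at_infinity[OF e(1)] by simp
    show "set_borel_measurable lborel {0<..} (\<lambda>x::real. g (of_real x))"
    proof -
      have "(\<lambda>x. indicator {0<..} x *\<^sub>R g (of_real x)) \<in> borel_measurable borel"
        by (intro borel_measurable_continuous_on_indicator continuous_on_subset[OF cont']) auto
      thus ?thesis by (simp add: set_borel_measurable_def)
    qed
    have "norm (g (of_real x)) \<le> norm (K * (1 + x) powr (-1 - \<epsilon>))" if "x > 0" for x
      using e(2)[OF of_real_in_sector[OF \<theta>(1), of x]] that by (simp add: abs_mult)
        (smt (verit) mult_right_mono powr_ge_zero)
    thus "AE x in lborel. x \<in> {0<..} \<longrightarrow> norm (g (of_real x)) \<le> norm (K * (1 + x) powr (-1 - \<epsilon>))"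
      by auto
  qed
  thus "set_integrable lborel {0<..} (\<lambda>x::real. g (of_real x))" .

  define S' where "S' = {z. closed_segment 0 z \<subseteq> S}"
  have S': "open S'" unfolding S'_def by (rule open_segment_hull[OF S(1)])
  have SS: "S' \<subseteq> S" unfolding S'_def by auto
  have "0 \<in> sector \<theta>" using of_real_in_sector[OF \<theta>(1), of 0] by simp
  hence secS: "sector \<theta> \<subseteq> S'"
    using S(2) closed_segment_subset[OF _ _ convex_sector[OF \<theta>]] unfolding S'_def by blast
  have star: "starlike S'"
    unfolding starlike_def
  proof (intro bexI[of _ 0] ballI subsetI)
    show "0 \<in> S'" using secS \<open>0 \<in> sector \<theta>\<close> by auto
    fix z x assume z: "z \<in> S'" "x \<in> closed_segment 0 z"
    hence "closed_segment 0 x \<subseteq> closed_segment 0 z" by (simp add: subset_closed_segment)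
    thus "x \<in> S'" using z(1) by (auto simp: S'_def)
  qed
  have "\<exists>G1. \<forall>z\<in>S'. (G1 has_field_derivative g z) (at z)"
  proof (rule holomorphic_starlike_primitive[OF _ star S' finite.emptyI])
    show "continuous_on S' g" "\<And>x. x \<in> S' - {} \<Longrightarrow> g field_differentiable at x"
      using S' holomorphic_on_subset[OF g SS]
      by (auto intro: holomorphic_on_imp_continuous_on holomorphic_on_imp_differentiable_at)
  qed
  then obtain G1 where G1: "\<And>z. z \<in> S' \<Longrightarrow> (G1 has_field_derivative g z) (at z)"
    by blast
  define I where "I = (LBINT x:{0<..}. g (of_real x))"
  have ray: "((\<lambda>x::real. G1 (of_real x)) \<longlongrightarrow> G1 0 + I) at_top"
  proof -
    have "((\<lambda>y. LINT x|lborel. indicator {..y} x *\<^sub>R (indicator {0<..} x *\<^sub>R g (of_real x))) \<longlongrightarrow> I) at_top"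
      unfolding I_def set_lebesgue_integral_def
      using int by (intro tendsto_integral_at_top) (auto simp: set_integrable_def)
    hence "((\<lambda>y. G1 0 + (LINT x|lborel. indicator {..y} x *\<^sub>R (indicator {0<..} x *\<^sub>R g (of_real x)))) \<longlongrightarrow> G1 0 + I) at_top"
      by (intro tendsto_intros)
    moreover have "eventually (\<lambda>y::real. y > 0) at_top" by (rule eventually_gt_at_top)
    hence "eventually (\<lambda>y. G1 0 + (LINT x|lborel. indicator {..y} x *\<^sub>R (indicator {0<..} x *\<^sub>R g (of_real x))) = G1 (of_real y)) at_top"
    proof eventually_elim
      case (elim y)
      have "(LINT x|lborel. indicator {..y} x *\<^sub>R (indicator {0<..} x *\<^sub>R g (of_real x))) = (LBINT x:{0<..y}. g (of_real x))"
        unfolding set_lebesgue_integral_def by (intro Bochner_Integration.integral_cong) (auto simp: indicator_def)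
      also have "\<dots> = (LBINT x=0..y. g (of_real x))"
        using elim by (simp add: interval_integral_Ioc zero_ereal_def)
      also have "\<dots> = G1 (of_real y) - G1 (of_real 0)"
        unfolding zero_ereal_def
      proof (rule interval_integral_FTC_finite)
        show "continuous_on {min 0 y..max 0 y} (\<lambda>x. g (of_real x))"
          using elim by (intro continuous_on_subset[OF cont']) auto
        show "((\<lambda>x. G1 (of_real x)) has_vector_derivative g (of_real x)) (at x within {min 0 y..max 0 y})"
          if "min 0 y \<le> x" for x
          using that elim secS of_real_in_sector[OF \<theta>(1), of x]
          by (intro has_vector_derivative_real_field G1) auto
      qed
      finally show ?case by simp
    qed
    ultimately show ?thesis by (rule Lim_transform_eventually)
  qed
  define G where "G z = G1 z - (G1 0 + I)" for z
  have "(\<lambda>m. G (of_nat m * w)) \<longlonglongrightarrow> 0" if w: "w \<in> sector \<theta>" "w \<noteq> 0" for w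
  proof -
    define c where "c = cos \<theta> * norm w"
    have c: "c > 0" using w \<theta> cos_gt_zero_pi[of \<theta>] by (simp add: c_def)
    have "filterlim (\<lambda>m. real m * norm w) at_top sequentially"
      using w by real_asymp
    hence "(\<lambda>m. G1 (of_real (real m * norm w))) \<longlonglongrightarrow> G1 0 + I"
      by (rule filterlim_compose[OF ray])
    moreover have "(\<lambda>m. G1 (of_nat m * w) - G1 (of_real (real m * norm w))) \<longlonglongrightarrow> 0"
    proof (rule Lim_null_comparison)
      show "(\<lambda>m. \<bar>K\<bar> * (1 + real m * c) powr (-1 - \<epsilon>) * (2 * (real m * norm w))) \<longlonglongrightarrow> 0"
        using c w e(1) by real_asymp
      have "norm (G1 (of_nat m * w) - G1 (of_real (real m * norm w)))
              \<le> \<bar>K\<bar> * (1 + real m * c) powr (-1 - \<epsilon>) * (2 * (real m * norm w))" for m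
      proof -
        \<comment> \<open>A convex set avoiding a neighbourhood of \<open>0\<close> proportional to \<open>m\<close>, since \<open>norm z \<ge> Re z\<close>.\<close>
        define X where "X = sector \<theta> \<inter> {z. Re z \<ge> real m * c}"
        have X: "convex X" unfolding X_def by (intro convex_Int convex_sector \<theta> convex_halfspace_Re_ge)
        have "real m * c \<le> real m * Re w"
          unfolding c_def by (intro mult_left_mono Re_sector_ge \<theta> w) auto
        hence 1: "of_nat m * w \<in> X"
          using sector_scale[OF w(1), of "real m"] by (simp add: X_def)
        have "real m * c \<le> real m * norm w"
          unfolding c_def using mult_right_mono[of "cos \<theta>" 1 "norm w"] by (intro mult_left_mono) auto
        hence 2: "of_real (real m * norm w) \<in> X"
          using of_real_in_sector[OF \<theta>(1), of "real m * norm w"] by (simp add: X_def)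
        have "norm (G1 (of_nat m * w) - G1 (of_real (real m * norm w)))
           \<le> \<bar>K\<bar> * (1 + real m * c) powr (-1 - \<epsilon>) * norm (of_nat m * w - of_real (real m * norm w))"
        proof (rule field_differentiable_bound[OF X _ _ 1 2])
          fix z assume z: "z \<in> X"
          thus "(G1 has_field_derivative g z) (at z within X)"
            using secS by (intro has_field_derivative_at_within[OF G1]) (auto simp: X_def)
          have "norm (g z) \<le> K * (1 + norm z) powr (-1 - \<epsilon>)" using z by (intro e) (auto simp: X_def)
          also have "\<dots> \<le> \<bar>K\<bar> * (1 + real m * c) powr (-1 - \<epsilon>)"
            using z c e(1) complex_Re_le_cmod[of z]
            by (intro mult_mono powr_mono2') (auto simp: X_def add_pos_nonneg)
          finally show "norm (g z) \<le> \<bar>K\<bar> * (1 + real m * c) powr (-1 - \<epsilon>)" .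
        qed
        also have "norm (of_nat m * w - of_real (real m * norm w)) \<le> 2 * (real m * norm w)"
          by (rule order_trans[OF norm_triangle_ineq4]) (simp add: norm_mult)
        finally show ?thesis by (simp add: mult_left_mono)
      qed
      thus "eventually (\<lambda>m. norm (G1 (of_nat m * w) - G1 (of_real (real m * norm w)))
              \<le> \<bar>K\<bar> * (1 + real m * c) powr (-1 - \<epsilon>) * (2 * (real m * norm w))) sequentially"
        by simp
    qed
    ultimately have "(\<lambda>m. (G1 (of_nat m * w) - G1 (of_real (real m * norm w))) + G1 (of_real (real m * norm w)) - (G1 0 + I))
        \<longlonglongrightarrow> 0 + (G1 0 + I) - (G1 0 + I)"
      by (intro tendsto_intros)
    thus ?thesis by (simp add: G_def)
  qed
  moreover have "(G has_field_derivative g z) (at z)" if "z \<in> sector \<theta>" for z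
    unfolding G_def [abs_def] using that secS by (auto intro!: derivative_eq_intros G1)
  moreover have "G 0 = - I" by (simp add: G_def)
  ultimately show "\<exists>G. (\<forall>z\<in>sector \<theta>. (G has_field_derivative g z) (at z)) \<and>
             (\<forall>w\<in>sector \<theta> - {0}. (\<lambda>m. G (of_nat m * w)) \<longlonglongrightarrow> 0) \<and>
             G 0 = - (LBINT x:{0<..}. g (of_real x))"
    unfolding I_def by blast
qed

text \<open>
Euler--Maclaurin for the chain of derivatives \<open>G, g, g', \<dots>\<close>, where \<open>G\<close> is the primitive of \<open>g\<close> that
vanishes at infinity. The integral enters as \<open>- G 0\<close>.\<close>

lemma holomorphic_sum_asymptotics:
  fixes a :: real and N :: nat
  assumes \<theta>: "0 \<le> \<theta>" "\<theta> < pi / 2" and S: "open S" "sector \<theta> \<subseteq> S" and a: "a > 0"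
    and g: "g holomorphic_on S" and decay: "\<And>k. sufficient_decay (sector \<theta>) ((deriv ^^ k) g)"
  shows "\<exists>K. \<forall>w\<in>sector \<theta> - {0}. norm w \<le> 1 \<longrightarrow>
           norm (w * (\<Sum>m. g (w * of_real (real m + a))) - (LBINT x:{0<..}. g (of_real x))
              + (\<Sum>n<N. of_real (bernoulli_poly (Suc n) a / fact (Suc n)) * (deriv ^^ n) g 0 * w ^ Suc n))
            \<le> K * norm w ^ Suc N"
proof -
  have decay0: "sufficient_decay (sector \<theta>) g" using decay[of 0] by simp
  from decaying_primitive(2)[OF \<theta> S g decay0] obtain G where G:
    "\<And>z. z \<in> sector \<theta> \<Longrightarrow> (G has_field_derivative g z) (at z)"
    "\<And>w. w \<in> sector \<theta> \<Longrightarrow> w \<noteq> 0 \<Longrightarrow> (\<lambda>m. G (of_nat m * w)) \<longlonglongrightarrow> 0"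
    "G 0 = - (LBINT x:{0<..}. g (of_real x))" by blast
  define D where "D n = (case n of 0 \<Rightarrow> G | Suc k \<Rightarrow> (deriv ^^ k) g)" for n
  define h where "h = (deriv ^^ Suc N) g"
  have h: "continuous_on (sector \<theta>) h" "sufficient_decay (sector \<theta>) h"
  proof -
    have "continuous_on S h"
      unfolding h_def by (intro holomorphic_on_imp_continuous_on holomorphic_higher_deriv g S(1))
    thus "continuous_on (sector \<theta>) h" by (rule continuous_on_subset[OF _ S(2)])
    show "sufficient_decay (sector \<theta>) h" unfolding h_def by (rule decay)
  qed
  obtain \<epsilon> K where e: "\<epsilon> > 0" "\<And>z. z \<in> sector \<theta> \<Longrightarrow> norm (h z) \<le> K * (1 + norm z) powr (-1 - \<epsilon>)"
    using sufficient_decay_uniform[OF h(2) closed_sector[OF \<theta>] h(1)] by blast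
  define K' where "K' = ((\<Sum>n\<le>N. \<bar>bernoulli_poly n a / fact n\<bar>) + \<bar>a\<bar> ^ (N + 1)) * K * (1 + 1 / \<epsilon>)"
  have "norm (w * (\<Sum>m. g (w * of_real (real m + a))) - (LBINT x:{0<..}. g (of_real x))
              + (\<Sum>n<N. of_real (bernoulli_poly (Suc n) a / fact (Suc n)) * (deriv ^^ n) g 0 * w ^ Suc n))
          \<le> K' * norm w ^ Suc N" if w: "w \<in> sector \<theta>" "w \<noteq> 0" "norm w \<le> 1" for w
  proof -
    have "norm (w * (\<Sum>m. D 1 (w * of_real (real m + a)))
                 + (\<Sum>n\<le>N. of_real (bernoulli_poly n a / fact n) * w ^ n * D n 0))
         \<le> ((\<Sum>n\<le>N. \<bar>bernoulli_poly n a / fact n\<bar>) + \<bar>a\<bar> ^ (N + 1)) * K * (1 + 1 / \<epsilon>) * norm w ^ (N + 1)"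
    proof (rule euler_maclaurin_cone[OF convex_sector[OF \<theta>] cone_sector w a e(1)])
      show "(D n has_field_derivative D (Suc n) z) (at z within sector \<theta>)" if "z \<in> sector \<theta>" for n z
      proof (rule has_field_derivative_at_within, cases n)
        case 0
        thus "(D n has_field_derivative D (Suc n) z) (at z)" using G(1)[OF that] by (simp add: D_def)
      next
        case (Suc k)
        have "z \<in> S" using that S(2) by blast
        from has_field_derivative_higher_deriv[OF g S(1) this, of k]
        show "(D n has_field_derivative D (Suc n) z) (at z)" unfolding D_def Suc nat.case .
      qed
      show "norm (D (N + 2) z) \<le> K * (1 + norm z) powr (-1 - \<epsilon>)" if "z \<in> sector \<theta>" for z
        using e(2)[OF that] by (simp add: D_def h_def)
      show "summable (\<lambda>m. D 1 (w * of_real (real m + a)))"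
        using sufficient_decay_summable[OF decay0 w(1,2), of a] by (simp add: D_def)
      show "(\<lambda>m. D n (of_nat m * w)) \<longlonglongrightarrow> 0" for n
      proof (cases n)
        case 0
        thus ?thesis using G(2) w by (simp add: D_def)
      next
        case (Suc k)
        have "(\<lambda>m. (deriv ^^ k) g (w * of_real (real m + 0))) \<longlonglongrightarrow> 0"
          by (intro summable_LIMSEQ_zero sufficient_decay_summable[OF decay w(1,2)])
        thus ?thesis using Suc by (simp add: D_def mult.commute)
      qed
    qed
    moreover have "(\<Sum>n\<le>N. of_real (bernoulli_poly n a / fact n) * w ^ n * D n 0)
        = - (LBINT x:{0<..}. g (of_real x))
              + (\<Sum>n<N. of_real (bernoulli_poly (Suc n) a / fact (Suc n)) * (deriv ^^ n) g 0 * w ^ Suc n)"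
      unfolding lessThan_Suc_atMost [symmetric]
      by (subst sum.lessThan_Suc_shift) (simp add: D_def G(3) mult_ac del: fact_Suc)
    moreover have "D 1 = g" by (simp add: D_def)
    ultimately show ?thesis
      by (simp only: K'_def Suc_eq_plus1 diff_conv_add_uminus add.assoc)
  qed
  thus ?thesis by blast
qed

section \<open>Summands with a simple pole\<close>

lemma has_laurent_expansion_exp_over_id:
  "(\<lambda>z. exp (- z) / z) has_laurent_expansion fls_shift 1 (fps_to_fls (fps_exp (-1 :: complex)))"
proof -
  have "(\<lambda>z::complex. exp (- z) * z powi (-1)) has_laurent_expansion fls_shift 1 (fps_to_fls (fps_exp (-1)))"
    by (intro has_laurent_expansion_shift' has_laurent_expansion_fps has_fps_expansion_exp_neg1)
  thus ?thesis by (simp add: power_int_minus field_simps)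
qed

lemma simple_pole_subdegree:
  assumes "f has_laurent_expansion b" "is_pole f 0" "zorder f 0 = -1"
  shows "fls_subdegree b = -1"
proof -
  have "b \<noteq> 0" using is_pole_0_imp_neg_fls_subdegree[OF assms(1,2)] by auto
  thus ?thesis using has_laurent_expansion_zorder_0[OF assms(1)] assms(3) by simp
qed

text \<open>The function \<open>exp (- z) / z\<close> has the principal part \<open>1 / z\<close> and decays in the sector together with
all its derivatives. Subtracting the right multiple removes the pole without spoiling the decay.\<close>

lemma subtract_simple_pole:
  fixes f :: "complex \<Rightarrow> complex" and b :: "complex fls"
  assumes S: "open S" "0 \<in> S" and f: "f holomorphic_on S - {0}"
    and b: "f has_laurent_expansion b" "fls_subdegree b = -1"
  defines "\<beta> \<equiv> fls_nth b (-1)"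
  obtains g where "g holomorphic_on S" "\<And>z. z \<noteq> 0 \<Longrightarrow> g z = f z - \<beta> * (exp (- z) / z)"
    "\<And>n. (deriv ^^ n) g 0 = fact n * (fls_nth b (int n) - \<beta> * ((-1) ^ Suc n / fact (Suc n)))"
proof -
  define F where "F = Abs_fps (\<lambda>n. fls_nth b (int n) - \<beta> * ((-1) ^ Suc n / fact (Suc n)))"
  let ?f = "\<lambda>z. f z - \<beta> * (exp (- z) / z)"
  have "?f has_laurent_expansion (b - fls_const \<beta> * fls_shift 1 (fps_to_fls (fps_exp (-1))))"
    by (intro laurent_expansion_intros b(1) has_laurent_expansion_exp_over_id)
  also have "b - fls_const \<beta> * fls_shift 1 (fps_to_fls (fps_exp (-1))) = fps_to_fls F"
  proof (rule fls_eqI)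
    fix n :: int
    consider "n \<ge> 0" | "n = -1" | "n < -1" by linarith
    thus "fls_nth (b - fls_const \<beta> * fls_shift 1 (fps_to_fls (fps_exp (-1)))) n = fls_nth (fps_to_fls F) n"
    proof cases
      case 1
      then obtain k where "n = int k" using nonneg_int_cases by blast
      moreover have "nat (int k + 1) = Suc k" by simp
      ultimately show ?thesis by (simp add: F_def del: fact_Suc power_Suc)
    next
      case 2
      thus ?thesis by (simp add: \<beta>_def)
    next
      case 3
      thus ?thesis using b(2) by simp
    qed
  qed
  finally have exp: "(\<lambda>z. if z = 0 then fps_nth F 0 else ?f z) has_fps_expansion F"
    by (rule has_fps_expansion_fps_to_fls)
  define g where "g = (\<lambda>z. if z = 0 then fps_nth F 0 else ?f z)"
  have "g holomorphic_on S"
  proof (rule no_isolated_singularity'[of "{0}"])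
    show "(g \<longlongrightarrow> g z) (at z within S)" if "z \<in> {0}" for z
      using has_fps_expansion_imp_continuous[OF exp, of S] that unfolding g_def continuous_within by auto
    have "?f holomorphic_on S - {0}"
      by (intro holomorphic_intros f) auto
    thus "g holomorphic_on S - {0}"
      by (rule holomorphic_transform) (auto simp: g_def)
  qed (use S in auto)
  moreover have "g z = ?f z" if "z \<noteq> 0" for z using that by (simp add: g_def)
  moreover have "(deriv ^^ n) g 0 = fact n * (fls_nth b (int n) - \<beta> * ((-1) ^ Suc n / fact (Suc n)))" for n
  proof -
    have "fps_nth F n = (deriv ^^ n) g 0 / fact n"
      using fps_nth_fps_expansion[OF exp, of n] by (simp only: g_def)
    hence "(deriv ^^ n) g 0 = fact n * fps_nth F n" by simp
    thus ?thesis unfolding F_def fps_nth_Abs_fps .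
  qed
  ultimately show ?thesis by (rule that)
qed

lemma laurent_truncation_bigo:
  fixes f :: "complex \<Rightarrow> complex" and b :: "complex fls"
  assumes b: "f has_laurent_expansion b" "fls_subdegree b = -1"
  shows "(\<lambda>z. f z - fls_nth b (-1) / z - (\<Sum>n<N. fls_nth b (int n) * z ^ n)) \<in> O[at 0](\<lambda>z. z ^ N)"
proof -
  \<comment> \<open>The Laurent series of the left-hand side; all its coefficients below \<open>N\<close> vanish.\<close>
  define L where "L = b - fls_shift 1 (fls_const (fls_nth b (-1))) - (\<Sum>n<N. fls_const (fls_nth b (int n)) * fls_X ^ n)"
  have nth: "fls_nth L k = (if 0 \<le> k \<and> k < int N \<or> k < 0 then 0 else fls_nth b k)" for k
  proof -
    have "fls_nth (\<Sum>n<N. fls_const (fls_nth b (int n)) * fls_X ^ n) k = (\<Sum>n<N. if k = int n then fls_nth b k else 0)"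
      by (subst fls_nth_sum) (auto intro!: sum.cong simp: fls_X_power_conv_shift_1)
    also have "\<dots> = (if 0 \<le> k \<and> k < int N then fls_nth b k else 0)"
    proof (cases "0 \<le> k")
      case True
      then obtain j where "k = int j" using nonneg_int_cases by blast
      thus ?thesis by simp
    next
      case False
      thus ?thesis by (intro trans[OF sum.neutral]) auto
    qed
    finally show ?thesis using b(2) unfolding L_def by (cases "k = -1") auto
  qed
  have "(\<lambda>z. f z - fls_nth b (-1) * z powi (-1) - (\<Sum>n<N. fls_nth b (int n) * z ^ n)) has_laurent_expansion L"
    unfolding L_def by (intro laurent_expansion_intros b(1))
  hence "(\<lambda>z. (f z - fls_nth b (-1) * z powi (-1) - (\<Sum>n<N. fls_nth b (int n) * z ^ n)) * z powi (- int N))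
           has_laurent_expansion fls_shift (int N) L"
    by (rule has_laurent_expansion_shift')
  moreover have "fls_subdegree (fls_shift (int N) L) \<ge> 0"
    by (cases "fls_shift (int N) L = 0") (auto intro!: fls_subdegree_geI simp: nth)
  ultimately have "((\<lambda>z. (f z - fls_nth b (-1) * z powi (-1) - (\<Sum>n<N. fls_nth b (int n) * z ^ n)) * z powi (- int N))
      \<longlongrightarrow> fls_nth (fls_shift (int N) L) 0) (at 0)"
    by (rule has_laurent_expansion_imp_tendsto_0)
  hence "((\<lambda>z. (f z - fls_nth b (-1) / z - (\<Sum>n<N. fls_nth b (int n) * z ^ n)) / z ^ N)
      \<longlongrightarrow> fls_nth (fls_shift (int N) L) 0) (at 0)"
    by (simp add: power_int_minus divide_inverse)
  moreover have "eventually (\<lambda>z::complex. z \<noteq> 0) (at 0)" by (rule eventually_neq_at_within)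
  hence "eventually (\<lambda>z::complex. z ^ N \<noteq> 0) (at 0)" by eventually_elim simp
  ultimately show ?thesis by (rule bigoI_tendsto)
qed

text \<open>The constant \<open>I\<close> is a parameter because it does not change when \<open>a\<close> is shifted by \<open>1\<close>.\<close>

definition expansion_error :: "(complex \<Rightarrow> complex) \<Rightarrow> complex fls \<Rightarrow> complex \<Rightarrow> nat \<Rightarrow> real \<Rightarrow> complex \<Rightarrow> complex" where
  "expansion_error f b I N a w = (\<Sum>m. f (w * of_real (real m + a)))
        - (fls_nth b (-1) * Ln (1 / w) / w
           + fls_nth b (-1) * of_real (C_const a) / w
           + 1 / w * I
           - (\<Sum>n<N. of_real (bernoulli_poly (n + 1) a) * fls_nth b (int n) / of_nat (n + 1) * w ^ n))"

text \<open>Passing from \<open>a + 1\<close> to \<open>a\<close> adds the single summand \<open>f (w * a)\<close>. By the recurrences for the constant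
and for the Bernoulli polynomials, the expansion changes by exactly the Laurent polynomial of \<open>f\<close>
at \<open>w * a\<close> up to order \<open>N\<close>. For negative \<open>a\<close> the point \<open>w * a\<close> lies outside the sector, but it is
close to \<open>0\<close>, where the Laurent expansion holds in every direction.\<close>

lemma expansion_error_shift:
  fixes a :: real and N :: nat
  assumes a: "a \<notin> \<int>\<^sub>\<le>\<^sub>0" and b: "f has_laurent_expansion b" "fls_subdegree b = -1"
    and sm: "\<And>w. w \<in> T - {0} \<Longrightarrow> summable (\<lambda>m. f (w * of_real (real m + a)))"
    and R: "expansion_error f b I N (a + 1) \<in> O[at 0 within T](\<lambda>w. w ^ N)"
  shows "expansion_error f b I N a \<in> O[at 0 within T](\<lambda>w. w ^ N)"
proof -
  have a0: "a \<noteq> 0" using a by auto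
  let ?r = "\<lambda>z. f z - fls_nth b (-1) / z - (\<Sum>n<N. fls_nth b (int n) * z ^ n)"
  have "filterlim (\<lambda>w. w * complex_of_real a) (at 0) (at 0 within T)"
    using a0 by (auto simp: filterlim_at eventually_at_filter intro!: tendsto_eq_intros)
  from landau_o.big.compose[OF laurent_truncation_bigo[OF b, of N] this]
  have "(\<lambda>w. ?r (w * of_real a)) \<in> O[at 0 within T](\<lambda>w. (w * of_real a) ^ N)" .
  also have "(\<lambda>w. (w * complex_of_real a) ^ N) \<in> O[at 0 within T](\<lambda>w. w ^ N)"
    by (simp add: power_mult_distrib)
  finally have "(\<lambda>w. ?r (w * of_real a) + expansion_error f b I N (a + 1) w) \<in> O[at 0 within T](\<lambda>w. w ^ N)"
    using R by (rule sum_in_bigo)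
  moreover have "eventually (\<lambda>w. expansion_error f b I N a w = ?r (w * of_real a) + expansion_error f b I N (a + 1) w) (at 0 within T)"
  proof -
    have "eventually (\<lambda>w. w \<in> T - {0}) (at 0 within T)" by (auto simp: eventually_at_filter)
    thus ?thesis
    proof eventually_elim
      case (elim w)
      have sum: "(\<Sum>m. f (w * of_real (real m + a))) = f (w * of_real a) + (\<Sum>m. f (w * of_real (real m + (a + 1))))"
        using suminf_split_head[OF sm[OF elim]] by (simp add: add_ac)
      have "(\<Sum>n<N. of_real (bernoulli_poly (n + 1) (a + 1)) * fls_nth b (int n) / of_nat (n + 1) * w ^ n)
          = (\<Sum>n<N. of_real (bernoulli_poly (n + 1) a) * fls_nth b (int n) / of_nat (n + 1) * w ^ n
                 + fls_nth b (int n) * (w * of_real a) ^ n)"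
      proof (intro sum.cong refl)
        fix n
        have "complex_of_nat (n + 1) \<noteq> 0" by (metis of_nat_eq_0_iff add_is_0 one_neq_zero)
        moreover have "of_real (bernoulli_poly (n + 1) (a + 1)) =
            complex_of_real (bernoulli_poly (n + 1) a) + of_nat (n + 1) * of_real a ^ n"
          using bernoulli_poly_plus1[of n a] by simp
        ultimately show "of_real (bernoulli_poly (n + 1) (a + 1)) * fls_nth b (int n) / of_nat (n + 1) * w ^ n
            = of_real (bernoulli_poly (n + 1) a) * fls_nth b (int n) / of_nat (n + 1) * w ^ n
                 + fls_nth b (int n) * (w * of_real a) ^ n"
          by (simp only:) (simp add: add_divide_distrib distrib_right distrib_left power_mult_distrib del: of_nat_Suc of_nat_add)
      qed
      hence bern: "(\<Sum>n<N. of_real (bernoulli_poly (n + 1) (a + 1)) * fls_nth b (int n) / of_nat (n + 1) * w ^ n)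
          = (\<Sum>n<N. of_real (bernoulli_poly (n + 1) a) * fls_nth b (int n) / of_nat (n + 1) * w ^ n)
             + (\<Sum>n<N. fls_nth b (int n) * (w * of_real a) ^ n)"
        by (simp only: sum.distrib)
      have C: "fls_nth b (-1) * complex_of_real (C_const a) / w
             = fls_nth b (-1) * of_real (C_const (a + 1)) / w + fls_nth b (-1) / (w * of_real a)"
        using elim a0 unfolding C_const_plus1[OF a] by (simp add: field_simps)
      show ?case
        unfolding expansion_error_def sum bern C by simp
    qed
  qed
  ultimately show ?thesis by (subst landau_o.big.in_cong)
qed

text \<open>For positive \<open>a\<close> all sample points lie in the sector, and the expansions of the sums for \<open>g\<close> and for
\<open>exp (- z) / z\<close> can be added.\<close>

lemma expansion_error_pos:
  fixes f :: "complex \<Rightarrow> complex" and b :: "complex fls" and \<theta> a :: real and N :: nat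
  assumes \<theta>: "0 \<le> \<theta>" "\<theta> < pi / 2" and S: "open S" "sector \<theta> \<subseteq> S" and a: "a > 0"
    and g: "g holomorphic_on S" and decay: "\<And>k. sufficient_decay (sector \<theta>) ((deriv ^^ k) g)"
    and fg: "\<And>z. z \<noteq> 0 \<Longrightarrow> g z = f z - fls_nth b (-1) * (exp (- z) / z)"
    and coeff: "\<And>n. (deriv ^^ n) g 0 = fact n * (fls_nth b (int n) - fls_nth b (-1) * ((-1) ^ Suc n / fact (Suc n)))"
  shows "expansion_error f b (LBINT x:{0<..}. g (of_real x)) N a \<in> O[at 0 within sector \<theta>](\<lambda>w. w ^ N)"
proof -
  define \<beta> where "\<beta> = fls_nth b (-1)"
  define I where "I = (LBINT x:{0<..}. g (of_real x))"
  define B where "B n = bernoulli_poly (Suc n) a" for n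
  define P where "P w = (\<Sum>n<N. of_real (B n / (fact (Suc n) * real (Suc n)) * (-1) ^ n) * w ^ Suc n)" for w :: complex
  define Q where "Q w = (\<Sum>n<N. of_real (B n / fact (Suc n)) * (deriv ^^ n) g 0 * w ^ Suc n)" for w
  from holomorphic_sum_asymptotics[OF \<theta> S a g decay, of N] obtain K1 where K1:
    "\<And>w. w \<in> sector \<theta> \<Longrightarrow> w \<noteq> 0 \<Longrightarrow> norm w \<le> 1 \<Longrightarrow>
      norm (w * (\<Sum>m. g (w * of_real (real m + a))) - I + Q w) \<le> K1 * norm w ^ Suc N"
    unfolding Q_def I_def B_def by blast
  from damped_harmonic_asymptotics[OF \<theta> a, of N] obtain K2 where K2:
    "\<And>w. w \<in> sector \<theta> \<Longrightarrow> w \<noteq> 0 \<Longrightarrow> norm w \<le> 1 \<Longrightarrow>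
      norm (damped_harmonic a w + Ln w - of_real (C_const a) - P w) \<le> K2 * norm w ^ Suc N"
    unfolding P_def B_def by blast
  have bound: "norm (expansion_error f b I N a w) \<le> (K1 + norm \<beta> * K2) * norm (w ^ N)"
    if w: "w \<in> sector \<theta>" "w \<noteq> 0" "norm w \<le> 1" for w
  proof -
    have Re: "Re w > 0" using Re_sector_pos[OF \<theta> w(1,2)] .
    have Ln: "Ln (1 / w) = - Ln w"
      using Re Ln_inverse[of w] by (auto simp: complex_nonpos_Reals_iff inverse_eq_divide)
    have nz: "w * of_real (real m + a) \<noteq> 0" for m
    proof -
      have "complex_of_real (real m + a) \<noteq> 0" using a by (simp del: of_real_add)
      thus ?thesis using w by simp
    qed
    have sg: "summable (\<lambda>m. g (w * of_real (real m + a)))"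
      using sufficient_decay_summable[OF decay[of 0] w(1,2)] by simp
    have "(\<lambda>m. g (w * of_real (real m + a)) + \<beta> / w * (exp (- (w * of_real (real m + a))) / of_real (real m + a)))
        sums ((\<Sum>m. g (w * of_real (real m + a))) + \<beta> / w * damped_harmonic a w)"
      unfolding damped_harmonic_def
      by (intro sums_add sums_mult summable_sums sg summable_damped_harmonic Re a)
    also have "(\<lambda>m. g (w * of_real (real m + a)) + \<beta> / w * (exp (- (w * of_real (real m + a))) / of_real (real m + a)))
        = (\<lambda>m. f (w * of_real (real m + a)))"
      by (simp add: fg[OF nz] \<beta>_def del: of_real_add)
    finally have sum: "(\<Sum>m. f (w * of_real (real m + a))) = (\<Sum>m. g (w * of_real (real m + a))) + \<beta> / w * damped_harmonic a w"
      by (simp only: sums_iff)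
    have QP: "Q w - \<beta> * P w = w * (\<Sum>n<N. of_real (B n) * fls_nth b (int n) / of_nat (n + 1) * w ^ n)"
    proof -
      have "of_real (B n / fact (Suc n)) * (deriv ^^ n) g 0 * w ^ Suc n
          - \<beta> * (of_real (B n / (fact (Suc n) * real (Suc n)) * (-1) ^ n) * w ^ Suc n)
          = w * (of_real (B n) * fls_nth b (int n) / of_nat (n + 1) * w ^ n)" for n
      proof -
        have nz: "complex_of_nat (Suc n) \<noteq> 0" "(fact n :: complex) \<noteq> 0" by (simp_all del: of_nat_Suc)
        show ?thesis
          unfolding coeff \<beta>_def [symmetric] using nz
          by (simp add: divide_simps del: of_nat_Suc) (simp add: algebra_simps)
      qed
      thus ?thesis unfolding Q_def P_def sum_distrib_left by (simp only: sum_subtractf [symmetric])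
    qed
    have "w * expansion_error f b I N a w = (w * (\<Sum>m. g (w * of_real (real m + a))) - I + Q w)
         + \<beta> * (damped_harmonic a w + Ln w - of_real (C_const a) - P w)"
    proof -
      have "w * expansion_error f b I N a w = w * (\<Sum>m. g (w * of_real (real m + a))) + \<beta> * damped_harmonic a w
          + \<beta> * Ln w - \<beta> * of_real (C_const a) - I
          + w * (\<Sum>n<N. of_real (B n) * fls_nth b (int n) / of_nat (n + 1) * w ^ n)"
        unfolding expansion_error_def sum Ln \<beta>_def [symmetric] B_def Suc_eq_plus1 using w(2)
        by (simp add: distrib_left right_diff_distrib)
      thus ?thesis unfolding QP [symmetric] by (simp add: algebra_simps)
    qed
    hence "norm w * norm (expansion_error f b I N a w) = norm ((w * (\<Sum>m. g (w * of_real (real m + a))) - I + Q w)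
         + \<beta> * (damped_harmonic a w + Ln w - of_real (C_const a) - P w))"
      by (simp only: norm_mult [symmetric])
    also have "\<dots> \<le> norm (w * (\<Sum>m. g (w * of_real (real m + a))) - I + Q w)
         + norm \<beta> * norm (damped_harmonic a w + Ln w - of_real (C_const a) - P w)"
      by (subst norm_mult [symmetric]) (rule norm_triangle_ineq)
    also have "\<dots> \<le> K1 * norm w ^ Suc N + norm \<beta> * (K2 * norm w ^ Suc N)"
      by (intro add_mono mult_left_mono K1 K2 w norm_ge_zero)
    also have "\<dots> = norm w * ((K1 + norm \<beta> * K2) * norm (w ^ N))"
      by (simp add: algebra_simps norm_power)
    finally show ?thesis using w(2) by simp
  qed
  have "eventually (\<lambda>w. norm (expansion_error f b I N a w) \<le> (K1 + norm \<beta> * K2) * norm (w ^ N)) (at 0 within sector \<theta>)"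
    unfolding eventually_at using bound by (intro exI[of _ 1]) (auto simp: dist_norm)
  thus ?thesis unfolding I_def by (rule bigoI)
qed

theorem theorem1p3:
  fixes f :: "complex \<Rightarrow> complex" and S :: "complex set" and b :: "complex fls"
    and \<theta> a :: real and N :: nat
  assumes "0 \<le> \<theta>" and "\<theta> < pi / 2"
    and "open S" and "connected S" and "sector \<theta> \<subseteq> S"
    and "f holomorphic_on (S - {0})"
    and "is_pole f 0" and "zorder f 0 = -1"
    and "\<And>k. sufficient_decay (sector \<theta>) ((deriv ^^ k) f)"
    and "f has_laurent_expansion b"
    and "a \<notin> \<int>\<^sub>\<le>\<^sub>0"
  shows "(\<forall>w\<in>sector \<theta> - {0}. summable (\<lambda>m. f (w * of_real (real m + a)))) \<and>
    set_integrable lborel {0<..}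
      (\<lambda>x::real. f (of_real x) - fls_nth b (-1) * of_real (exp (-x)) / of_real x) \<and>
    (\<lambda>w. (\<Sum>m. f (w * of_real (real m + a)))
        - (fls_nth b (-1) * Ln (1 / w) / w
           + fls_nth b (-1) * of_real (C_const a) / w
           + 1 / w * (LBINT x:{0<..}. f (of_real x) - fls_nth b (-1) * of_real (exp (-x)) / of_real x)
           - (\<Sum>n<N. of_real (bernoulli_poly (n + 1) a) * fls_nth b (int n) / of_nat (n + 1) * w ^ n)))
      \<in> O[at 0 within sector \<theta>](\<lambda>w. w ^ N)"
proof (intro conjI ballI)
  note \<theta> = assms(1,2)
  have decay_f: "sufficient_decay (sector \<theta>) f" using assms(9)[of 0] by simp
  have sm: "summable (\<lambda>m. f (w * of_real (real m + x)))" if "w \<in> sector \<theta> - {0}" for w x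
    using that by (intro sufficient_decay_summable[OF decay_f]) auto
  thus "summable (\<lambda>m. f (w * of_real (real m + a)))" if "w \<in> sector \<theta> - {0}" for w
    using that .
  define \<beta> where "\<beta> = fls_nth b (-1)"
  have sub: "fls_subdegree b = -1" by (rule simple_pole_subdegree) fact+
  have "0 \<in> S" using of_real_in_sector[OF \<theta>(1), of 0] assms(5) by auto
  from subtract_simple_pole[OF assms(3) this assms(6,10) sub] obtain g where
    g: "g holomorphic_on S" and fg: "\<And>z. z \<noteq> 0 \<Longrightarrow> g z = f z - \<beta> * (exp (- z) / z)" and
    coeff: "\<And>n. (deriv ^^ n) g 0 = fact n * (fls_nth b (int n) - \<beta> * ((-1) ^ Suc n / fact (Suc n)))"
    unfolding \<beta>_def by blast
  have decay: "sufficient_decay (sector \<theta>) ((deriv ^^ k) g)" for k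
  proof -
    let ?e = "\<lambda>z::complex. exp (- z) * poly [:0, 1:] (1 / z)"
    obtain q where q: "\<And>z. z \<noteq> 0 \<Longrightarrow> (deriv ^^ k) ?e z = exp (- z) * poly q (1 / z)"
      using higher_deriv_exp_poly[of k "[:0, 1:]"] by blast
    have op: "open (S - {0})" using assms(3) by auto
    have hol: "?e holomorphic_on S - {0}" "(\<lambda>z. \<beta> * ?e z) holomorphic_on S - {0}"
      by (auto intro!: holomorphic_intros)
    have deriv_eq: "(deriv ^^ k) f z - \<beta> * (exp (- z) * poly q (1 / z)) = (deriv ^^ k) g z"
      if z: "z \<in> sector \<theta>" "z \<noteq> 0" for z
    proof -
      have zS: "z \<in> S - {0}" using z assms(5) by auto
      have "(deriv ^^ k) g z = (deriv ^^ k) (\<lambda>z. f z - \<beta> * ?e z) z"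
      proof (rule higher_deriv_transform_within_open[OF _ _ op zS])
        show "g holomorphic_on S - {0}" using g by (rule holomorphic_on_subset) auto
        show "(\<lambda>z. f z - \<beta> * ?e z) holomorphic_on S - {0}"
          by (intro holomorphic_on_diff hol assms(6))
        show "g z = f z - \<beta> * ?e z" if "z \<in> S - {0}" for z using fg[of z] that by simp
      qed
      also have "\<dots> = (deriv ^^ k) f z - (deriv ^^ k) (\<lambda>z. \<beta> * ?e z) z"
        by (rule higher_deriv_diff[OF assms(6) hol(2) op zS])
      also have "(deriv ^^ k) (\<lambda>z. \<beta> * ?e z) z = \<beta> * (deriv ^^ k) ?e z"
        by (rule higher_deriv_cmult[OF hol(1) zS op])
      finally show ?thesis using q[OF z(2)] by simp
    qed
    have "sufficient_decay (sector \<theta>) (\<lambda>z. (deriv ^^ k) f z - \<beta> * (exp (- z) * poly q (1 / z)))"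
      by (rule sufficient_decay_diff[OF assms(9) sufficient_decay_cmult[OF sufficient_decay_exp_poly[OF \<theta>]]])
    also have "?this \<longleftrightarrow> ?thesis"
      by (rule sufficient_decay_cong) (rule deriv_eq)
    finally show ?thesis .
  qed
  have decay_g: "sufficient_decay (sector \<theta>) g" using decay[of 0] by simp
  have eq: "f (of_real x) - fls_nth b (-1) * of_real (exp (-x)) / of_real x = g (of_real x)" if "x > 0" for x :: real
    using that fg[of "of_real x"] by (simp add: \<beta>_def exp_of_real [symmetric])
  have "set_integrable lborel {0<..} (\<lambda>x::real. g (of_real x))"
    by (rule decaying_primitive(1)[OF \<theta> assms(3,5) g decay_g])
  also have "?this \<longleftrightarrow> set_integrable lborel {0<..}
      (\<lambda>x::real. f (of_real x) - fls_nth b (-1) * of_real (exp (-x)) / of_real x)"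
    using eq by (intro set_integrable_cong) auto
  finally show "set_integrable lborel {0<..}
      (\<lambda>x::real. f (of_real x) - fls_nth b (-1) * of_real (exp (-x)) / of_real x)" .
  define I where "I = (LBINT x:{0<..}. g (of_real x))"
  have I: "(LBINT x:{0<..}. f (of_real x) - fls_nth b (-1) * of_real (exp (-x)) / of_real x) = I"
    unfolding I_def using eq by (intro set_lebesgue_integral_cong) auto
  have "expansion_error f b I N x \<in> O[at 0 within sector \<theta>](\<lambda>w. w ^ N)" if "x \<notin> \<int>\<^sub>\<le>\<^sub>0" "x + real k > 0" for x k
    using that
  proof (induction k arbitrary: x)
    case 0
    thus ?case unfolding I_def
      using fg coeff by (intro expansion_error_pos[OF \<theta> assms(3,5) _ g decay]) (auto simp: \<beta>_def)
  next
    case (Suc k)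
    have "x + 1 \<notin> \<int>\<^sub>\<le>\<^sub>0" using Suc.prems(1) plus_one_in_nonpos_Ints_imp by blast
    hence "expansion_error f b I N (x + 1) \<in> O[at 0 within sector \<theta>](\<lambda>w. w ^ N)"
      using Suc.prems(2) by (intro Suc.IH) auto
    with sm show ?case by (rule expansion_error_shift[OF Suc.prems(1) assms(10) sub])
  qed
  moreover obtain k where "-a < real k" using reals_Archimedean2 by blast
  hence "a + real k > 0" by linarith
  ultimately have "expansion_error f b I N a \<in> O[at 0 within sector \<theta>](\<lambda>w. w ^ N)"
    using assms(11) by blast
  thus "(\<lambda>w. (\<Sum>m. f (w * of_real (real m + a)))
        - (fls_nth b (-1) * Ln (1 / w) / w
           + fls_nth b (-1) * of_real (C_const a) / w
           + 1 / w * (LBINT x:{0<..}. f (of_real x) - fls_nth b (-1) * of_real (exp (-x)) / of_real x)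
           - (\<Sum>n<N. of_real (bernoulli_poly (n + 1) a) * fls_nth b (int n) / of_nat (n + 1) * w ^ n)))
      \<in> O[at 0 within sector \<theta>](\<lambda>w. w ^ N)"
    unfolding I expansion_error_def [abs_def] .
qed

end
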